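(* Let $\gamma\subset\mathbb R^{n+1}$, $n\ge1$, be a $C^\infty$-smooth hypersurface, either closed strictly convex or local (a small contractible representative of a germ), equipped with the induced Riemannian metric. For $f\in C^\infty(\gamma)$ let $H_f(x,w)=-2\sqrt{1-\|w\|^2}\,f(x)$ on $T_{<1}\gamma=\{(x,w)\in T\gamma:\|w\|<1\}$. The vector space over $\mathbb R$ generated by the Poisson brackets $\{H_f,H_g\}$, $f,g\in C^\infty(\gamma)$, is a Lie algebra under the Poisson bracket, in which each element can be represented as a sum of at most $2n+1$ Poisson brackets $\{H_f,H_g\}$. It consists of the functions on $T_{<1}\gamma$ of the form $(x,w)\mapsto\eta_x(w)$, where $\eta$ is an arbitrary $C^\infty$-smooth 1-form on $\gamma$, and is thus identified with the space of $C^\infty$-smooth 1-forms on $\gamma$. The Lie algebra structure thus obtained on the 1-forms is isomorphic to the Lie algebra of all $C^\infty$-smooth vector fields on $\gamma$ (with the Lie bracket) via the duality isomorphism $T^*\gamma\to T\gamma$ given by the metric.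
   Context: On the tangent bundle of a Riemannian manifold $\gamma$, with projection $\pi:T\gamma\to\gamma$, the Liouville form is $\alpha(v)=\langle w,\pi_*v\rangle$ for $v\in T_{(x,w)}(T\gamma)$, and the standard symplectic form is $\omega=d\alpha$. The Poisson bracket is taken with respect to $\omega$, with the sign convention that in canonical coordinates in which $\omega=\sum_j dw_j\wedge dz_j$ one has $\{F,G\}=\sum_j\left(\frac{\partial F}{\partial w_j}\frac{\partial G}{\partial z_j}-\frac{\partial F}{\partial z_j}\frac{\partial G}{\partial w_j}\right)$. *)

theory Defs
  imports "HOL-Analysis.Analysis" "HOL-Library.Function_Algebras"
begin

text \<open>Real-valued and vector-valued functions form a real vector space under the pointwise
  operations.\<close>

instantiation "fun" :: (type, real_vector) real_vector
begin

definition scaleR_fun :: "real \<Rightarrow> ('a \<Rightarrow> 'b) \<Rightarrow> 'a \<Rightarrow> 'b"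
  where "scaleR_fun c f = (\<lambda>x. c *\<^sub>R f x)"

instance
  by standard (simp_all add: scaleR_fun_def fun_eq_iff scaleR_add_right scaleR_add_left)

end


section \<open>Lie algebras over the reals\<close>

text \<open>The underlying vector space is a subspace L of an ambient real vector space.\<close>

definition lie_algebra :: "'v::real_vector set \<Rightarrow> ('v \<Rightarrow> 'v \<Rightarrow> 'v) \<Rightarrow> bool"
  where "lie_algebra L br \<longleftrightarrow>
    subspace L \<and>
    (\<forall>x\<in>L. \<forall>y\<in>L. br x y \<in> L) \<and>
    (\<forall>x\<in>L. \<forall>y\<in>L. \<forall>z\<in>L. br (x + y) z = br x z + br y z \<and> br x (y + z) = br x y + br x z) \<and>
    (\<forall>c. \<forall>x\<in>L. \<forall>y\<in>L. br (c *\<^sub>R x) y = c *\<^sub>R br x y \<and> br x (c *\<^sub>R y) = c *\<^sub>R br x y) \<and>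
    (\<forall>x\<in>L. br x x = 0) \<and>
    (\<forall>x\<in>L. \<forall>y\<in>L. \<forall>z\<in>L. br x (br y z) + br y (br z x) + br z (br x y) = 0)"

definition lie_isomorphism ::
    "('v::real_vector \<Rightarrow> 'w::real_vector) \<Rightarrow> 'v set \<Rightarrow> ('v \<Rightarrow> 'v \<Rightarrow> 'v) \<Rightarrow>
      'w set \<Rightarrow> ('w \<Rightarrow> 'w \<Rightarrow> 'w) \<Rightarrow> bool"
  where "lie_isomorphism h L brL M brM \<longleftrightarrow>
    bij_betw h L M \<and>
    (\<forall>x\<in>L. \<forall>y\<in>L. h (x + y) = h x + h y) \<and>
    (\<forall>c. \<forall>x\<in>L. h (c *\<^sub>R x) = c *\<^sub>R h x) \<and>
    (\<forall>x\<in>L. \<forall>y\<in>L. h (brL x y) = brM (h x) (h y))"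


section \<open>Smooth maps on open sets\<close>

text \<open>These are meant for open sets in Euclidean spaces.\<close>

primrec Ck_on ::
    "nat \<Rightarrow> ('a::real_normed_vector \<Rightarrow> 'b::real_normed_vector) \<Rightarrow> 'a set \<Rightarrow> bool"
  where
    "Ck_on 0 f U \<longleftrightarrow> continuous_on U f"
  | "Ck_on (Suc k) f U \<longleftrightarrow>
       (\<forall>x\<in>U. f differentiable at x) \<and> (\<forall>v. Ck_on k (\<lambda>x. frechet_derivative f (at x) v) U)"

definition smooth_on ::
    "('a::real_normed_vector \<Rightarrow> 'b::real_normed_vector) \<Rightarrow> 'a set \<Rightarrow> bool"
  where "smooth_on f U \<longleftrightarrow> (\<forall>k. Ck_on k f U)"


section \<open>Hypersurfaces\<close>

text \<open>Embedded hypersurfaces, by the local slice condition: near each of its points the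
  hypersurface is carried onto a piece of a hyperplane by an ambient diffeomorphism.\<close>

definition smooth_hypersurface :: "'a::euclidean_space set \<Rightarrow> bool"
  where "smooth_hypersurface \<gamma> \<longleftrightarrow>
    (\<forall>p\<in>\<gamma>. \<exists>U V \<Phi> \<Psi> (e::'a). open U \<and> open V \<and> p \<in> U \<and>
       homeomorphism U V \<Phi> \<Psi> \<and> smooth_on \<Phi> U \<and> smooth_on \<Psi> V \<and>
       e \<noteq> 0 \<and> \<Phi> ` (\<gamma> \<inter> U) = {y\<in>V. e \<bullet> y = 0})"

text \<open>A closed strictly convex hypersurface is the boundary of a strictly convex body.
  No positivity of the second fundamental form is required.\<close>

definition closed_strictly_convex :: "'a::euclidean_space set \<Rightarrow> bool"
  where "closed_strictly_convex \<gamma> \<longleftrightarrow>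
    (\<exists>K. compact K \<and> interior K \<noteq> {} \<and>
       (\<forall>x\<in>K. \<forall>y\<in>K. x \<noteq> y \<longrightarrow> open_segment x y \<subseteq> interior K) \<and> \<gamma> = frontier K)"

text \<open>A nonempty contractible hypersurface is a contractible representative of its germ at
  any of its points; no bound on its size is imposed. (In the library the empty set is
  contractible.)\<close>

definition local_hypersurface :: "'a::euclidean_space set \<Rightarrow> bool"
  where "local_hypersurface \<gamma> \<longleftrightarrow> \<gamma> \<noteq> {} \<and> contractible \<gamma>"


section \<open>Calculus on embedded submanifolds\<close>

text \<open>The set M below stands for an embedded submanifold of a Euclidean space. It is used for
  a hypersurface, for its tangent bundle (a submanifold of the product of the ambient space
  with itself) and for relatively open subsets of these.

  Objects on M are represented by total functions. Wherever objects are compared or form a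
  vector space they are normalised to vanish off their domain.\<close>

definition curve_at ::
    "'a::euclidean_space set \<Rightarrow> 'a \<Rightarrow> 'a \<Rightarrow> (real \<Rightarrow> 'a) \<Rightarrow> bool"
  where "curve_at M p v c \<longleftrightarrow>
    (\<exists>\<epsilon>>0. smooth_on c {-\<epsilon><..<\<epsilon>} \<and> c ` {-\<epsilon><..<\<epsilon>} \<subseteq> M) \<and>
    c 0 = p \<and> (c has_vector_derivative v) (at 0)"

definition tangent_space :: "'a::euclidean_space set \<Rightarrow> 'a \<Rightarrow> 'a set"
  where "tangent_space M p = {v. \<exists>c. curve_at M p v c}"

definition tangent_bundle :: "'a::euclidean_space set \<Rightarrow> ('a \<times> 'a) set"
  where "tangent_bundle M = {(x, w). x \<in> M \<and> w \<in> tangent_space M x}"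

definition smooth_fun ::
    "'a::euclidean_space set \<Rightarrow> ('a \<Rightarrow> 'b::real_normed_vector) \<Rightarrow> bool"
  where "smooth_fun M f \<longleftrightarrow>
    (\<forall>p\<in>M. \<exists>U F. open U \<and> p \<in> U \<and> smooth_on F U \<and> (\<forall>x\<in>M \<inter> U. F x = f x))"

text \<open>The differential of f : M \<rightarrow> E at p, applied to a tangent vector v: the
  velocity of the image of any curve in M that passes through p with velocity v.\<close>

definition mdiff ::
    "'a::euclidean_space set \<Rightarrow> ('a \<Rightarrow> 'b::real_normed_vector) \<Rightarrow> 'a \<Rightarrow> 'a \<Rightarrow> 'b"
  where "mdiff M f p v =
    (THE d. \<forall>c. curve_at M p v c \<longrightarrow> ((f \<circ> c) has_vector_derivative d) (at 0))"

definition vector_fields :: "'a::euclidean_space set \<Rightarrow> ('a \<Rightarrow> 'a) set"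
  where "vector_fields M =
    {X. smooth_fun M X \<and> (\<forall>x\<in>M. X x \<in> tangent_space M x) \<and> (\<forall>x. x \<notin> M \<longrightarrow> X x = 0)}"

text \<open>The Lie bracket as commutator of derivations: [X,Y] f = X (Y f) - Y (X f).\<close>

definition lie_bracket ::
    "'a::euclidean_space set \<Rightarrow> ('a \<Rightarrow> 'a) \<Rightarrow> ('a \<Rightarrow> 'a) \<Rightarrow> 'a \<Rightarrow> 'a"
  where "lie_bracket M X Y p =
    (if p \<in> M then
       (THE v. v \<in> tangent_space M p \<and>
          (\<forall>f::'a \<Rightarrow> real. smooth_fun M f \<longrightarrow>
             mdiff M f p v =
               mdiff M (\<lambda>q. mdiff M f q (Y q)) p (X p) -
               mdiff M (\<lambda>q. mdiff M f q (X q)) p (Y p)))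
     else 0)"

text \<open>A smooth 1-form on M is locally the restriction to the tangent spaces of M of a 1-form
  \<open>\<Sum>\<^sub>i b\<^sub>i dx\<^sub>i\<close> with smooth coefficients on an open subset of the ambient space. In
  particular it is linear on each tangent space.\<close>

definition one_forms :: "'a::euclidean_space set \<Rightarrow> ('a \<Rightarrow> 'a \<Rightarrow> real) set"
  where "one_forms M =
    {\<eta>. (\<forall>p\<in>M. \<exists>U b. open U \<and> p \<in> U \<and> smooth_on b U \<and>
            (\<forall>x\<in>M \<inter> U. \<forall>v\<in>tangent_space M x. \<eta> x v = b x \<bullet> v)) \<and>
         (\<forall>x v. (x, v) \<notin> tangent_bundle M \<longrightarrow> \<eta> x v = 0)}"

text \<open>The exterior derivative of a 1-form, by the invariant formula
  \<open>d\<beta>(X,Y) = X(\<beta>(Y)) - Y(\<beta>(X)) - \<beta>([X,Y])\<close>, where X and Y are any smooth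
  vector fields on a neighbourhood of p in M extending the tangent vectors u and v.\<close>

definition ext_deriv ::
    "'a::euclidean_space set \<Rightarrow> ('a \<Rightarrow> 'a \<Rightarrow> real) \<Rightarrow> 'a \<Rightarrow> 'a \<Rightarrow> 'a \<Rightarrow> real"
  where "ext_deriv M \<beta> p u v =
    (THE d. \<forall>U X Y. open U \<and> p \<in> U \<and>
        X \<in> vector_fields (M \<inter> U) \<and> Y \<in> vector_fields (M \<inter> U) \<and> X p = u \<and> Y p = v \<longrightarrow>
        d = mdiff (M \<inter> U) (\<lambda>q. \<beta> q (Y q)) p u -
            mdiff (M \<inter> U) (\<lambda>q. \<beta> q (X q)) p v -
            \<beta> p (lie_bracket (M \<inter> U) X Y p))"

text \<open>The metric induced on M is the restriction of the inner product of the ambient space to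
  the tangent spaces. The map \<open>sharp M\<close> is the duality that it gives, from 1-forms to vector
  fields.\<close>

definition sharp ::
    "'a::euclidean_space set \<Rightarrow> ('a \<Rightarrow> 'a \<Rightarrow> real) \<Rightarrow> 'a \<Rightarrow> 'a"
  where "sharp M \<eta> x =
    (if x \<in> M then (THE v. v \<in> tangent_space M x \<and> (\<forall>w\<in>tangent_space M x. \<eta> x w = v \<bullet> w))
     else 0)"


section \<open>Symplectic structure of the tangent bundle\<close>

definition liouville :: "'a::euclidean_space set \<Rightarrow> 'a \<times> 'a \<Rightarrow> 'a \<times> 'a \<Rightarrow> real"
  where "liouville \<gamma> p v = snd p \<bullet> mdiff (tangent_bundle \<gamma>) fst p v"

definition symplectic ::
    "'a::euclidean_space set \<Rightarrow> 'a \<times> 'a \<Rightarrow> 'a \<times> 'a \<Rightarrow> 'a \<times> 'a \<Rightarrow> real"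
  where "symplectic \<gamma> = ext_deriv (tangent_bundle \<gamma>) (liouville \<gamma>)"

definition unit_bundle :: "'a::euclidean_space set \<Rightarrow> ('a \<times> 'a) set"
  where "unit_bundle \<gamma> = {(x, w). (x, w) \<in> tangent_bundle \<gamma> \<and> norm w < 1}"

text \<open>Signs: the Hamiltonian vector field is given by \<open>\<omega>(X\<^sub>F, \<cdot>) = - dF\<close>
  and the bracket by \<open>{F,G} = \<omega>(X\<^sub>F, X\<^sub>G) = dG(X\<^sub>F)\<close>. In coordinates with
  \<open>\<omega> = \<Sum>\<^sub>j dw\<^sub>j \<and> dz\<^sub>j\<close> this reads
  \<open>X\<^sub>F = \<Sum>\<^sub>j (\<partial>F/\<partial>w\<^sub>j \<partial>/\<partial>z\<^sub>j - \<partial>F/\<partial>z\<^sub>j \<partial>/\<partial>w\<^sub>j)\<close> and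
  \<open>{F,G} = \<Sum>\<^sub>j (\<partial>F/\<partial>w\<^sub>j \<partial>G/\<partial>z\<^sub>j - \<partial>F/\<partial>z\<^sub>j \<partial>G/\<partial>w\<^sub>j)\<close>.\<close>

definition ham_field ::
    "'a::euclidean_space set \<Rightarrow> ('a \<times> 'a \<Rightarrow> real) \<Rightarrow> 'a \<times> 'a \<Rightarrow> 'a \<times> 'a"
  where "ham_field \<gamma> F p =
    (THE v. v \<in> tangent_space (unit_bundle \<gamma>) p \<and>
       (\<forall>u\<in>tangent_space (unit_bundle \<gamma>) p. symplectic \<gamma> p v u = - mdiff (unit_bundle \<gamma>) F p u))"

definition poisson ::
    "'a::euclidean_space set \<Rightarrow> ('a \<times> 'a \<Rightarrow> real) \<Rightarrow> ('a \<times> 'a \<Rightarrow> real) \<Rightarrow> 'a \<times> 'a \<Rightarrow> real"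
  where "poisson \<gamma> F G p =
    (if p \<in> unit_bundle \<gamma> then symplectic \<gamma> p (ham_field \<gamma> F p) (ham_field \<gamma> G p) else 0)"


section \<open>The functions on the unit ball bundle\<close>

definition H :: "'a::euclidean_space set \<Rightarrow> ('a \<Rightarrow> real) \<Rightarrow> 'a \<times> 'a \<Rightarrow> real"
  where "H \<gamma> f = (\<lambda>(x, w). if (x, w) \<in> unit_bundle \<gamma> then - 2 * sqrt (1 - (norm w)\<^sup>2) * f x else 0)"

definition H_brackets :: "'a::euclidean_space set \<Rightarrow> ('a \<times> 'a \<Rightarrow> real) set"
  where "H_brackets \<gamma> = {poisson \<gamma> (H \<gamma> f) (H \<gamma> g) | f g. smooth_fun \<gamma> f \<and> smooth_fun \<gamma> g}"

definition form_fun ::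
    "'a::euclidean_space set \<Rightarrow> ('a \<Rightarrow> 'a \<Rightarrow> real) \<Rightarrow> 'a \<times> 'a \<Rightarrow> real"
  where "form_fun \<gamma> \<eta> = (\<lambda>(x, w). if (x, w) \<in> unit_bundle \<gamma> then \<eta> x w else 0)"

text \<open>The Poisson bracket carried over to 1-forms along \<open>form_fun\<close>.\<close>

definition form_bracket ::
    "'a::euclidean_space set \<Rightarrow> ('a \<Rightarrow> 'a \<Rightarrow> real) \<Rightarrow> ('a \<Rightarrow> 'a \<Rightarrow> real) \<Rightarrow> 'a \<Rightarrow> 'a \<Rightarrow> real"
  where "form_bracket \<gamma> \<eta> \<theta> =
    inv_into (one_forms \<gamma>) (form_fun \<gamma>) (poisson \<gamma> (form_fun \<gamma> \<eta>) (form_fun \<gamma> \<theta>))"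

end

theory Submission
  imports Defs
begin

text \<open>
  In ambient coordinates \<open>(x, w)\<close>, the Liouville form of the hypersurface is the restriction of
  \<open>w \<bullet> dx\<close> to the tangent bundle, so \<open>\<omega>\<close> is the restriction of \<open>\<Sum> dw\<^sub>i \<and> dx\<^sub>i\<close>
  (\<open>symplectic_eq\<close>). If \<open>dF = A \<bullet> dw + B \<bullet> dx\<close> and \<open>dG = A' \<bullet> dw + B' \<bullet> dx\<close> along the tangent
  bundle, with A and A' tangent to the hypersurface, this gives
  \<open>{F, G} = B' \<bullet> A - B \<bullet> A'\<close> (\<open>poisson_eq\<close>). All functions that occur here have such
  differentials, and two computations result:

  \<^item> \<open>{H\<^sub>f, H\<^sub>g}\<close> is the function of the 1-form \<open>4 (g df - f dg)\<close> (\<open>poisson_H\<close>);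

  \<^item> for vector fields X and Y, the functions \<open>X(x) \<bullet> w\<close> and \<open>Y(x) \<bullet> w\<close> have the bracket
    \<open>[X, Y](x) \<bullet> w\<close> (\<open>poisson_momentum\<close>).

  By the second one, \<open>X \<mapsto> (X(x) \<bullet> w)\<close> carries the Lie algebra of vector fields isomorphically to
  the functions of 1-forms. It remains to see that the brackets of the first kind span all of
  these. Given a 1-form with dual vector field X, write it as \<open>\<Sum> X\<^sub>i dx\<^sub>i\<close> in the \<open>n + 1\<close> ambient
  coordinates. Then
  \<open>X\<^sub>i dx\<^sub>i = (X\<^sub>i dx\<^sub>i - x\<^sub>i dX\<^sub>i) / 2 + d(x\<^sub>i X\<^sub>i) / 2\<close>, where the first term is a bracket with
  \<open>f = x\<^sub>i / 8\<close> and \<open>g = X\<^sub>i\<close>, and the sum of the exact terms is a single bracket, with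
  \<open>f = x \<bullet> X / 8\<close> and \<open>g = 1\<close> (\<open>momentum_as_sum_of_brackets\<close>). These are
  \<open>n + 2 \<le> 2 n + 1\<close> brackets. The functions \<open>x\<^sub>i\<close> and \<open>X\<^sub>i\<close> are globally defined, because the dual
  vector field is: it arises from the local coefficients of the 1-form by orthogonal projection to
  the tangent spaces (\<open>sharp_vector_field\<close>).

  The calculus on the hypersurface and on its tangent bundle is done with local smooth retractions
  (\<open>smooth_retraction\<close>) and extensions to the ambient space. The Lie bracket is
  \<open>[X, Y] = DY X - DX Y\<close> for arbitrary extensions (\<open>lie_bracket_eq\<close>), by the symmetry of second
  derivatives, and the Jacobi identity is that of commutators of derivations.
\<close>


section \<open>Calculus of smooth maps\<close>

abbreviation dderiv ::
    "('a::real_normed_vector \<Rightarrow> 'b::real_normed_vector) \<Rightarrow> 'a \<Rightarrow> 'a \<Rightarrow> 'b"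
  where "dderiv f x \<equiv> frechet_derivative f (at x)"

lemma dderiv_eqI: "(f has_derivative f') (at x) \<Longrightarrow> dderiv f x = f'"
  using frechet_derivative_at by metis

text \<open>The recursion for \<open>Ck_on\<close> speaks of the chosen value \<open>frechet_derivative\<close>; this
  introduction rule accepts any derivative that is given by a formula. Openness matters because
  two functions that agree on U have equal derivatives only at interior points.\<close>

lemma Ck_on_Suc_has_derivative:
  assumes "\<And>x. x \<in> U \<Longrightarrow> (f has_derivative f' x) (at x)"
    and "\<And>v. Ck_on k (\<lambda>x. f' x v) U" and "open U"
  shows "Ck_on (Suc k) f U"
proof -
  \<comment> \<open>Needed here for the derivatives; the general congruence rule below is in turn a consequence
      of this lemma.\<close>
  have cong: "Ck_on k g U \<Longrightarrow> (\<And>x. x \<in> U \<Longrightarrow> g x = h x) \<Longrightarrow> Ck_on k h U"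
    for g h :: "'a \<Rightarrow> 'b"
  proof (induction k arbitrary: g h)
    case 0
    then show ?case by (simp cong: continuous_on_cong)
  next
    case (Suc k)
    have d: "(h has_derivative dderiv g x) (at x)" if "x \<in> U" for x
      using that Suc.prems assms(3)
      by (auto intro: has_derivative_transform_within_open simp: frechet_derivative_works)
    then have "dderiv g x = dderiv h x" if "x \<in> U" for x
      using that dderiv_eqI by metis
    then have "Ck_on k (\<lambda>x. dderiv h x v) U" for v
      using Suc.IH[of "\<lambda>x. dderiv g x v" "\<lambda>x. dderiv h x v"] Suc.prems by simp
    then show ?case
      using d by (auto simp: differentiable_def)
  qed
  have "Ck_on k (\<lambda>x. dderiv f x v) U" for v
    by (rule cong[OF assms(2)[of v]]) (simp add: dderiv_eqI[OF assms(1)])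
  then show ?thesis
    using assms(1) by (auto simp: differentiable_def)
qed

lemma Ck_on_cong:
  assumes "Ck_on k f U" "\<And>x. x \<in> U \<Longrightarrow> f x = g x" "open U"
  shows "Ck_on k g U"
proof (cases k)
  case 0
  then show ?thesis using assms by (simp cong: continuous_on_cong)
next
  case (Suc j)
  show ?thesis unfolding Suc
  proof (rule Ck_on_Suc_has_derivative)
    fix x assume "x \<in> U"
    then show "(g has_derivative dderiv f x) (at x)"
      using assms Suc
      by (auto intro: has_derivative_transform_within_open simp: frechet_derivative_works)
  qed (use assms Suc in auto)
qed

lemma Ck_on_subset: "Ck_on k f U \<Longrightarrow> V \<subseteq> U \<Longrightarrow> Ck_on k f V"
  by (induction k arbitrary: f) (auto intro: continuous_on_subset)

lemma Ck_on_decrease: "Ck_on (Suc k) f U \<Longrightarrow> Ck_on k f U"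
proof (induction k arbitrary: f)
  case 0
  then show ?case
    by (auto intro!: continuous_at_imp_continuous_on differentiable_imp_continuous_within)
qed auto

lemma Ck_on_const: "Ck_on k (\<lambda>x. c) U"
  by (induction k arbitrary: c) auto

lemma Ck_on_linear: "bounded_linear f \<Longrightarrow> open U \<Longrightarrow> Ck_on k f U"
proof (cases k)
  case (Suc j)
  assume "bounded_linear f" "open U"
  then show ?thesis unfolding Suc
    by (intro Ck_on_Suc_has_derivative[where f' = "\<lambda>_. f"])
      (auto intro: bounded_linear_imp_has_derivative Ck_on_const)
qed (auto intro: linear_continuous_on)

lemma Ck_on_compose_linear:
  assumes "bounded_linear L" "Ck_on k f U" "open U"
  shows "Ck_on k (\<lambda>x. L (f x)) U"
  using assms(2)
proof (induction k arbitrary: f)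
  case 0
  then show ?case using assms by (auto intro: bounded_linear.continuous_on)
next
  case (Suc k)
  show ?case
  proof (rule Ck_on_Suc_has_derivative)
    fix x assume "x \<in> U"
    then show "((\<lambda>x. L (f x)) has_derivative (\<lambda>v. L (dderiv f x v))) (at x)"
      using Suc.prems by (auto intro: bounded_linear.has_derivative[OF assms(1)] simp: frechet_derivative_works)
  qed (use Suc assms in auto)
qed

lemma Ck_on_add:
  assumes "Ck_on k f U" "Ck_on k g U" "open U"
  shows "Ck_on k (\<lambda>x. f x + g x) U"
  using assms(1,2)
proof (induction k arbitrary: f g)
  case 0
  then show ?case by (auto intro: continuous_intros)
next
  case (Suc k)
  show ?case
  proof (rule Ck_on_Suc_has_derivative)
    fix x assume "x \<in> U"
    then show "((\<lambda>x. f x + g x) has_derivative (\<lambda>v. dderiv f x v + dderiv g x v)) (at x)"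
      using Suc.prems by (auto intro: has_derivative_add simp: frechet_derivative_works)
  qed (use Suc assms in auto)
qed

lemma Ck_on_sum:
  assumes "\<And>i. i \<in> A \<Longrightarrow> Ck_on k (f i) U" "open U"
  shows "Ck_on k (\<lambda>x. \<Sum>i\<in>A. f i x) U"
  using assms by (induction A rule: infinite_finite_induct) (auto intro: Ck_on_const Ck_on_add)

lemma Ck_on_bilinear:
  assumes "bounded_bilinear B" "Ck_on k f U" "Ck_on k g U" "open U"
  shows "Ck_on k (\<lambda>x. B (f x) (g x)) U"
  using assms(2,3)
proof (induction k arbitrary: f g)
  case 0
  then show ?case using bounded_bilinear.continuous_on[OF assms(1)] by auto
next
  case (Suc k)
  show ?case
  proof (rule Ck_on_Suc_has_derivative)
    fix x assume "x \<in> U"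
    then show "((\<lambda>x. B (f x) (g x)) has_derivative
        (\<lambda>v. B (f x) (dderiv g x v) + B (dderiv f x v) (g x))) (at x)"
      using Suc.prems
      by (auto intro: bounded_bilinear.FDERIV[OF assms(1)] simp: frechet_derivative_works)
  next
    fix v
    show "Ck_on k (\<lambda>x. B (f x) (dderiv g x v) + B (dderiv f x v) (g x)) U"
      using Suc.prems Ck_on_decrease[OF Suc.prems(1)] Ck_on_decrease[OF Suc.prems(2)] assms(4)
      by (intro Ck_on_add Suc.IH) auto
  qed fact
qed

text \<open>Along a linear combination of directions the derivative is the same combination of
  partial derivatives, so the derivative of a smooth map in a variable direction is built
  from finitely many smooth maps.\<close>

lemma dderiv_basis_expansion:
  fixes f :: "'a::euclidean_space \<Rightarrow> 'b::real_normed_vector"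
  assumes "f differentiable at x"
  shows "dderiv f x v = (\<Sum>b\<in>Basis. (v \<bullet> b) *\<^sub>R dderiv f x b)"
proof -
  have "linear (dderiv f x)"
    using assms by (rule linear_frechet_derivative)
  then have "dderiv f x (\<Sum>b\<in>Basis. (v \<bullet> b) *\<^sub>R b) = (\<Sum>b\<in>Basis. (v \<bullet> b) *\<^sub>R dderiv f x b)"
    by (simp add: linear_sum linear_cmul)
  then show ?thesis by (simp add: euclidean_representation)
qed

text \<open>The chain rule reduces order \<open>k + 1\<close> to sums of products of components of \<open>Dg\<close> with
  compositions \<open>(D\<^sub>b f) \<circ> g\<close> along the finitely many basis directions b, and the induction
  hypothesis for all f covers the latter.\<close>

lemma Ck_on_compose:
  fixes f :: "'b::euclidean_space \<Rightarrow> 'c::real_normed_vector"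
    and g :: "'a::real_normed_vector \<Rightarrow> 'b"
  assumes "Ck_on k f V" "Ck_on k g U" "g ` U \<subseteq> V" "open U" "open V"
  shows "Ck_on k (\<lambda>x. f (g x)) U"
  using assms(1,2)
proof (induction k arbitrary: f)
  case 0
  then show ?case
    using assms by (auto intro: continuous_on_compose2)
next
  case (Suc k)
  have f: "f differentiable at (g x)" and g: "g differentiable at x" if "x \<in> U" for x
    using that assms Suc.prems by auto
  show ?case
  proof (rule Ck_on_Suc_has_derivative)
    fix x assume x: "x \<in> U"
    have "((\<lambda>x. f (g x)) has_derivative (\<lambda>v. dderiv f (g x) (dderiv g x v))) (at x)"
      using f[OF x] g[OF x] diff_chain_at[of g _ x f]
      by (simp add: frechet_derivative_works o_def)
    moreover have "(\<lambda>v. dderiv f (g x) (dderiv g x v)) =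
        (\<lambda>v. \<Sum>b\<in>Basis. (dderiv g x v \<bullet> b) *\<^sub>R dderiv f (g x) b)"
      by (intro ext dderiv_basis_expansion f x)
    ultimately show "((\<lambda>x. f (g x)) has_derivative
        (\<lambda>v. \<Sum>b\<in>Basis. (dderiv g x v \<bullet> b) *\<^sub>R dderiv f (g x) b)) (at x)"
      by (rule back_subst)
  next
    fix v
    have "Ck_on k (\<lambda>x. dderiv f (g x) b) U" for b
      using Suc.prems Ck_on_decrease[of k g U] by (intro Suc.IH) auto
    moreover have "Ck_on k (\<lambda>x. dderiv g x v \<bullet> b) U" for b
      using Suc.prems assms(4)
      by (intro Ck_on_compose_linear[OF bounded_linear_inner_left]) auto
    ultimately show "Ck_on k (\<lambda>x. \<Sum>b\<in>Basis. (dderiv g x v \<bullet> b) *\<^sub>R dderiv f (g x) b) U"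
      using assms(4) by (intro Ck_on_sum Ck_on_bilinear[OF bounded_bilinear_scaleR]) auto
  qed fact
qed

lemma Ck_on_inverse:
  fixes f :: "'a::real_normed_vector \<Rightarrow> real"
  assumes "Ck_on k f U" "\<And>x. x \<in> U \<Longrightarrow> f x \<noteq> 0" "open U"
  shows "Ck_on k (\<lambda>x. inverse (f x)) U"
  using assms(1)
proof (induction k)
  case 0
  then show ?case using assms by (auto intro: continuous_intros)
next
  case (Suc k)
  show ?case
  proof (rule Ck_on_Suc_has_derivative)
    fix x assume x: "x \<in> U"
    show "((\<lambda>x. inverse (f x)) has_derivative
        (\<lambda>v. - (inverse (f x) * dderiv f x v * inverse (f x)))) (at x)"
      using Suc.prems x assms(2)[OF x]
      by (intro Deriv.has_derivative_inverse) (auto simp: frechet_derivative_works)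
  next
    fix v
    have "Ck_on k (\<lambda>x. inverse (f x)) U"
      using Suc Ck_on_decrease by blast
    then show "Ck_on k (\<lambda>x. - (inverse (f x) * dderiv f x v * inverse (f x))) U"
      using Suc.prems assms(3)
      by (intro Ck_on_compose_linear[OF bounded_linear_minus[OF bounded_linear_ident]]
          Ck_on_bilinear[OF bounded_bilinear_mult]) auto
  qed fact
qed

lemma smooth_on_cong:
  "smooth_on f U \<Longrightarrow> (\<And>x. x \<in> U \<Longrightarrow> f x = g x) \<Longrightarrow> open U \<Longrightarrow> smooth_on g U"
  unfolding smooth_on_def using Ck_on_cong by blast

lemma smooth_on_subset: "smooth_on f U \<Longrightarrow> V \<subseteq> U \<Longrightarrow> smooth_on f V"
  unfolding smooth_on_def using Ck_on_subset by blast

lemma smooth_on_differentiable: "smooth_on f U \<Longrightarrow> x \<in> U \<Longrightarrow> f differentiable at x"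
  unfolding smooth_on_def by (metis Ck_on.simps(2))

lemma smooth_on_has_derivative:
  "smooth_on f U \<Longrightarrow> x \<in> U \<Longrightarrow> (f has_derivative dderiv f x) (at x)"
  using smooth_on_differentiable frechet_derivative_works by blast

lemma smooth_on_continuous: "smooth_on f U \<Longrightarrow> continuous_on U f"
  unfolding smooth_on_def by (metis Ck_on.simps(1))

lemma smooth_on_const: "smooth_on (\<lambda>x. c) U"
  by (simp add: smooth_on_def Ck_on_const)

lemma smooth_on_linear: "bounded_linear f \<Longrightarrow> open U \<Longrightarrow> smooth_on f U"
  by (simp add: smooth_on_def Ck_on_linear)

lemma smooth_on_ident: "open U \<Longrightarrow> smooth_on (\<lambda>x. x) U"
  by (simp add: smooth_on_linear)

lemma smooth_on_compose_linear:
  "bounded_linear L \<Longrightarrow> smooth_on f U \<Longrightarrow> open U \<Longrightarrow> smooth_on (\<lambda>x. L (f x)) U"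
  by (simp add: smooth_on_def Ck_on_compose_linear)

lemma smooth_on_bilinear:
  "bounded_bilinear B \<Longrightarrow> smooth_on f U \<Longrightarrow> smooth_on g U \<Longrightarrow> open U \<Longrightarrow>
    smooth_on (\<lambda>x. B (f x) (g x)) U"
  by (simp add: smooth_on_def Ck_on_bilinear)

lemmas smooth_on_inner = smooth_on_bilinear[OF bounded_bilinear_inner]
lemmas smooth_on_scaleR = smooth_on_bilinear[OF bounded_bilinear_scaleR]

lemma smooth_on_add:
  "smooth_on f U \<Longrightarrow> smooth_on g U \<Longrightarrow> open U \<Longrightarrow> smooth_on (\<lambda>x. f x + g x) U"
  by (simp add: smooth_on_def Ck_on_add)

lemma smooth_on_diff:
  assumes "smooth_on f U" "smooth_on g U" "open U"
  shows "smooth_on (\<lambda>x. f x - g x) U"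
  using smooth_on_add[OF assms(1)
      smooth_on_compose_linear[OF bounded_linear_minus[OF bounded_linear_ident] assms(2,3)]] assms
  by simp

lemma smooth_on_sum:
  "(\<And>i. i \<in> A \<Longrightarrow> smooth_on (f i) U) \<Longrightarrow> open U \<Longrightarrow> smooth_on (\<lambda>x. \<Sum>i\<in>A. f i x) U"
  by (simp add: smooth_on_def Ck_on_sum)

lemma smooth_on_inverse:
  fixes f :: "'a::real_normed_vector \<Rightarrow> real"
  shows "smooth_on f U \<Longrightarrow> (\<And>x. x \<in> U \<Longrightarrow> f x \<noteq> 0) \<Longrightarrow> open U \<Longrightarrow>
    smooth_on (\<lambda>x. inverse (f x)) U"
  by (simp add: smooth_on_def Ck_on_inverse)

lemma smooth_on_compose:
  fixes f :: "'b::euclidean_space \<Rightarrow> 'c::real_normed_vector"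
  assumes "smooth_on f V" "smooth_on g U" "g ` U \<subseteq> V" "open U" "open V"
  shows "smooth_on (\<lambda>x. f (g x)) U"
  using assms(1,2) Ck_on_compose[OF _ _ assms(3-5)] unfolding smooth_on_def by blast

lemma smooth_on_Pair:
  assumes "smooth_on f U" "smooth_on g U" "open U"
  shows "smooth_on (\<lambda>x. (f x, g x)) U"
proof -
  have "smooth_on (\<lambda>x. (f x, 0) + (0, g x)) U"
    by (intro smooth_on_add smooth_on_compose_linear[of "\<lambda>y. (y, 0)"]
        smooth_on_compose_linear[of "\<lambda>y. (0, y)"] assms bounded_linear_Pair
        bounded_linear_ident bounded_linear_zero)
  then show ?thesis by simp
qed

lemma smooth_on_dderiv_fixed: "smooth_on f U \<Longrightarrow> smooth_on (\<lambda>x. dderiv f x v) U"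
  unfolding smooth_on_def by (metis Ck_on.simps(2))

lemma smooth_on_dderiv:
  fixes f :: "'b::euclidean_space \<Rightarrow> 'c::real_normed_vector"
  assumes "smooth_on f V" "smooth_on g U" "g ` U \<subseteq> V" "smooth_on X U" "open U" "open V"
  shows "smooth_on (\<lambda>x. dderiv f (g x) (X x)) U"
proof -
  have "smooth_on (\<lambda>x. \<Sum>b\<in>Basis. (X x \<bullet> b) *\<^sub>R dderiv f (g x) b) U"
    by (intro smooth_on_sum smooth_on_scaleR smooth_on_inner smooth_on_const assms
        smooth_on_compose[OF smooth_on_dderiv_fixed[OF assms(1)]])
  moreover have "(\<Sum>b\<in>Basis. (X x \<bullet> b) *\<^sub>R dderiv f (g x) b) = dderiv f (g x) (X x)"
    if "x \<in> U" for x
  proof -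
    have "g x \<in> V" using that assms(3) by auto
    then show ?thesis
      by (intro dderiv_basis_expansion[symmetric] smooth_on_differentiable[OF assms(1)])
  qed
  ultimately show ?thesis using assms(5) by (rule smooth_on_cong)
qed

definition grad :: "('a::euclidean_space \<Rightarrow> real) \<Rightarrow> 'a \<Rightarrow> 'a"
  where "grad f x = (\<Sum>b\<in>Basis. dderiv f x b *\<^sub>R b)"

lemma grad_inner:
  assumes "f differentiable at x"
  shows "grad f x \<bullet> v = dderiv f x v"
  using dderiv_basis_expansion[OF assms, of v]
  by (simp add: grad_def inner_sum_left inner_sum_right inner_commute[of _ v] mult.commute)

lemma smooth_on_grad: "smooth_on f U \<Longrightarrow> open U \<Longrightarrow> smooth_on (grad f) U"
  unfolding grad_def[abs_def]
  by (intro smooth_on_sum smooth_on_scaleR smooth_on_dderiv_fixed smooth_on_const)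

text \<open>Second derivatives are symmetric: by the mean value theorem, applied twice, the second
  difference of a real function over a parallelogram with sides \<open>t u\<close> and \<open>t v\<close> is
  \<open>t\<^sup>2\<close> times either mixed derivative at some point of the parallelogram.\<close>

lemma second_difference_mean_value:
  fixes f :: "'a::real_normed_vector \<Rightarrow> real"
  assumes f: "\<And>x. x \<in> U \<Longrightarrow> f differentiable at x"
    and f2: "\<And>x. x \<in> U \<Longrightarrow> (\<lambda>y. dderiv f y u) differentiable at x"
    and t: "t > 0"
    and U: "\<And>a b. 0 \<le> a \<Longrightarrow> a \<le> t \<Longrightarrow> 0 \<le> b \<Longrightarrow> b \<le> t \<Longrightarrow> p + a *\<^sub>R u + b *\<^sub>R v \<in> U"
  shows "\<exists>a b. 0 \<le> a \<and> a \<le> t \<and> 0 \<le> b \<and> b \<le> t \<and>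
    f (p + t *\<^sub>R u + t *\<^sub>R v) - f (p + t *\<^sub>R u) - f (p + t *\<^sub>R v) + f p =
      t\<^sup>2 * dderiv (\<lambda>y. dderiv f y u) (p + a *\<^sub>R u + b *\<^sub>R v) v"
proof -
  define \<phi> where "\<phi> s = f (p + s *\<^sub>R u + t *\<^sub>R v) - f (p + s *\<^sub>R u)" for s
  have line: "((\<lambda>s. h (q + s *\<^sub>R w)) has_real_derivative dderiv h (q + s *\<^sub>R w) w) (at s)"
    if "h differentiable at (q + s *\<^sub>R w)" for h :: "'a \<Rightarrow> real" and q w s
  proof -
    have 1: "((\<lambda>s. q + s *\<^sub>R w) has_derivative (\<lambda>r. r *\<^sub>R w)) (at s)"
      by (auto intro!: derivative_eq_intros)
    have "((\<lambda>s. h (q + s *\<^sub>R w)) has_derivative (\<lambda>r. dderiv h (q + s *\<^sub>R w) (r *\<^sub>R w))) (at s)"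
      using diff_chain_at[OF 1, of h] that by (simp add: frechet_derivative_works o_def)
    then show ?thesis
      using linear_cmul[OF linear_frechet_derivative[OF that]]
      by (simp add: has_field_derivative_def mult.commute[of _ "dderiv h (q + s *\<^sub>R w) w"])
  qed
  have d\<phi>: "(\<phi> has_real_derivative
      dderiv f (p + s *\<^sub>R u + t *\<^sub>R v) u - dderiv f (p + s *\<^sub>R u) u) (at s)"
    if "0 \<le> s" "s \<le> t" for s
  proof -
    have "((\<lambda>s. f (p + t *\<^sub>R v + s *\<^sub>R u) - f (p + s *\<^sub>R u)) has_real_derivative
      dderiv f (p + t *\<^sub>R v + s *\<^sub>R u) u - dderiv f (p + s *\<^sub>R u) u) (at s)"
      using U[of s t] U[of s 0] that t
      by (intro DERIV_diff line f) (simp_all add: ac_simps)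
    then show ?thesis by (simp add: \<phi>_def[abs_def] ac_simps)
  qed
  from MVT2[OF t d\<phi>] obtain a where a: "0 < a" "a < t"
    "\<phi> t - \<phi> 0 = (t - 0) * (dderiv f (p + a *\<^sub>R u + t *\<^sub>R v) u - dderiv f (p + a *\<^sub>R u) u)"
    by blast
  obtain b where b: "0 < b" "b < t"
    "dderiv f (p + a *\<^sub>R u + t *\<^sub>R v) u - dderiv f (p + a *\<^sub>R u + 0 *\<^sub>R v) u
      = (t - 0) * dderiv (\<lambda>y. dderiv f y u) (p + a *\<^sub>R u + b *\<^sub>R v) v"
  proof -
    have "((\<lambda>s. dderiv f (p + a *\<^sub>R u + s *\<^sub>R v) u) has_real_derivative
        dderiv (\<lambda>y. dderiv f y u) (p + a *\<^sub>R u + s *\<^sub>R v) v) (at s)" if "0 \<le> s" "s \<le> t" for s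
      using that a by (intro line f2 U) auto
    from MVT2[OF t this] show ?thesis using that by blast
  qed
  have "\<phi> t - \<phi> 0 = t\<^sup>2 * dderiv (\<lambda>y. dderiv f y u) (p + a *\<^sub>R u + b *\<^sub>R v) v"
    using a b by (simp add: power2_eq_square)
  then show ?thesis
    using a(1,2) b(1,2) by (intro exI[of _ a] exI[of _ b]) (simp add: \<phi>_def)
qed

text \<open>Dividing the second difference by \<open>t\<^sup>2\<close> and letting t run through \<open>1 / (n + 1)\<close>, both
  mixed derivatives at p are limits of the same sequence.\<close>

lemma second_derivative_symmetric_real:
  fixes f :: "'a::real_normed_vector \<Rightarrow> real"
  assumes "smooth_on f U" "open U" "p \<in> U"
  shows "dderiv (\<lambda>y. dderiv f y u) p v = dderiv (\<lambda>y. dderiv f y v) p u"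
proof -
  \<comment> \<open>A ball of radius \<open>R n\<close> about p contains the n-th parallelogram.\<close>
  define R where "R = (\<lambda>n. norm u / Suc n + norm v / Suc n)"
  define Q where "Q = (\<lambda>n. {q. dist q p \<le> R n})"
  have R: "R \<longlonglongrightarrow> 0"
    using tendsto_mult_right_zero[OF LIMSEQ_inverse_real_of_nat, of "norm u + norm v"]
    by (simp add: R_def divide_inverse algebra_simps)
  have close: "p + a *\<^sub>R x + b *\<^sub>R y \<in> Q n"
    if "0 \<le> a" "a \<le> 1 / Suc n" "0 \<le> b" "b \<le> 1 / Suc n" "{x, y} = {u, v}" for a b n x y
  proof -
    have "norm (a *\<^sub>R x + b *\<^sub>R y) \<le> a * norm x + b * norm y"
      using norm_triangle_ineq[of "a *\<^sub>R x" "b *\<^sub>R y"] that by simp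
    also have "\<dots> \<le> 1 / Suc n * norm x + 1 / Suc n * norm y"
      using that by (intro add_mono mult_right_mono) auto
    also have "\<dots> = R n"
      using that(5) by (auto simp: R_def doubleton_eq_iff)
    finally show ?thesis by (simp add: Q_def dist_norm add.assoc)
  qed
  obtain e where e: "e > 0" "ball p e \<subseteq> U"
    using assms open_contains_ball by blast
  have sm: "smooth_on (\<lambda>y. dderiv (\<lambda>y. dderiv f y x) y z) U" for x z
    by (intro smooth_on_dderiv_fixed assms)
  have diff: "f differentiable at y" "(\<lambda>y. dderiv f y x) differentiable at y" if "y \<in> U" for x y
    using smooth_on_differentiable[OF assms(1) that]
      smooth_on_differentiable[OF smooth_on_dderiv_fixed[OF assms(1)] that] by auto
  have "eventually (\<lambda>n. R n < e) sequentially"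
    using R e by (auto dest: order_tendstoD)
  then have ev: "eventually (\<lambda>n. Q n \<subseteq> U) sequentially"
    by eventually_elim (use e in \<open>auto simp: Q_def dist_commute\<close>)
  have lim: "(\<lambda>n. dderiv (\<lambda>y. dderiv f y x) (q n) z) \<longlonglongrightarrow> dderiv (\<lambda>y. dderiv f y x) p z"
    if "\<And>n. q n \<in> Q n" for q x z
  proof -
    have "(\<lambda>n. dist (q n) p) \<longlonglongrightarrow> 0"
      by (rule tendsto_sandwich[OF _ _ tendsto_const R]) (use that in \<open>auto simp: Q_def\<close>)
    then have "q \<longlonglongrightarrow> p"
      by (rule iffD2[OF tendsto_dist_iff])
    moreover have "isCont (\<lambda>y. dderiv (\<lambda>y. dderiv f y x) y z) p"
      using smooth_on_continuous[OF sm] assms by (simp add: continuous_on_eq_continuous_at)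
    ultimately show ?thesis by (rule isCont_tendsto_compose[rotated])
  qed
  define \<Delta> where "\<Delta> n = f (p + (1 / Suc n) *\<^sub>R u + (1 / Suc n) *\<^sub>R v) - f (p + (1 / Suc n) *\<^sub>R u)
      - f (p + (1 / Suc n) *\<^sub>R v) + f p" for n :: nat
  have "\<exists>q. q \<in> Q n \<and> (Q n \<subseteq> U \<longrightarrow> \<Delta> n = (1 / Suc n)\<^sup>2 * dderiv (\<lambda>y. dderiv f y u) q v)" for n
  proof (cases "Q n \<subseteq> U")
    case True
    have "\<exists>a b. 0 \<le> a \<and> a \<le> 1 / Suc n \<and> 0 \<le> b \<and> b \<le> 1 / Suc n \<and>
      \<Delta> n = (1 / Suc n)\<^sup>2 * dderiv (\<lambda>y. dderiv f y u) (p + a *\<^sub>R u + b *\<^sub>R v) v"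
      unfolding \<Delta>_def
      by (rule second_difference_mean_value[of U, OF diff(1) diff(2)])
        (use True close[of _ n _ u v] in auto)
    then show ?thesis using close by blast
  next
    case False
    have "p + 0 *\<^sub>R u + 0 *\<^sub>R v \<in> Q n" by (rule close) auto
    with False show ?thesis by blast
  qed
  then obtain q where q: "\<And>n. q n \<in> Q n"
    "\<And>n. Q n \<subseteq> U \<Longrightarrow> \<Delta> n = (1 / Suc n)\<^sup>2 * dderiv (\<lambda>y. dderiv f y u) (q n) v"
    by metis
  have "\<exists>q. q \<in> Q n \<and> (Q n \<subseteq> U \<longrightarrow> \<Delta> n = (1 / Suc n)\<^sup>2 * dderiv (\<lambda>y. dderiv f y v) q u)" for n
  proof (cases "Q n \<subseteq> U")
    case True
    have "\<exists>a b. 0 \<le> a \<and> a \<le> 1 / Suc n \<and> 0 \<le> b \<and> b \<le> 1 / Suc n \<and>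
      f (p + (1 / Suc n) *\<^sub>R v + (1 / Suc n) *\<^sub>R u) - f (p + (1 / Suc n) *\<^sub>R v)
        - f (p + (1 / Suc n) *\<^sub>R u) + f p =
      (1 / Suc n)\<^sup>2 * dderiv (\<lambda>y. dderiv f y v) (p + a *\<^sub>R v + b *\<^sub>R u) u"
      by (rule second_difference_mean_value[of U, OF diff(1) diff(2)])
        (use True close[of _ n _ v u] in auto)
    moreover have "f (p + (1 / Suc n) *\<^sub>R v + (1 / Suc n) *\<^sub>R u) - f (p + (1 / Suc n) *\<^sub>R v)
        - f (p + (1 / Suc n) *\<^sub>R u) + f p = \<Delta> n"
      by (simp add: \<Delta>_def ac_simps)
    moreover have "p + a *\<^sub>R v + b *\<^sub>R u \<in> Q n"
      if "0 \<le> a" "a \<le> 1 / Suc n" "0 \<le> b" "b \<le> 1 / Suc n" for a b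
      using that by (intro close) auto
    ultimately show ?thesis by auto
  next
    case False
    have "p + 0 *\<^sub>R u + 0 *\<^sub>R v \<in> Q n" by (rule close) auto
    with False show ?thesis by blast
  qed
  then obtain q' where q': "\<And>n. q' n \<in> Q n"
    "\<And>n. Q n \<subseteq> U \<Longrightarrow> \<Delta> n = (1 / Suc n)\<^sup>2 * dderiv (\<lambda>y. dderiv f y v) (q' n) u"
    by metis
  have "eventually (\<lambda>n. dderiv (\<lambda>y. dderiv f y v) (q' n) u = dderiv (\<lambda>y. dderiv f y u) (q n) v)
    sequentially"
    using ev by eventually_elim (use q(2) q'(2) in auto)
  then have "(\<lambda>n. dderiv (\<lambda>y. dderiv f y u) (q n) v) \<longlonglongrightarrow> dderiv (\<lambda>y. dderiv f y v) p u"
    using lim[OF q'(1)] by (rule Lim_transform_eventually[rotated])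
  then show ?thesis
    using lim[OF q(1)] LIMSEQ_unique by blast
qed

lemma second_derivative_symmetric:
  fixes f :: "'a::real_normed_vector \<Rightarrow> 'b::euclidean_space"
  assumes "smooth_on f U" "open U" "p \<in> U"
  shows "dderiv (\<lambda>y. dderiv f y u) p v = dderiv (\<lambda>y. dderiv f y v) p u"
proof (rule euclidean_eqI)
  fix b :: 'b assume "b \<in> Basis"
  have 1: "dderiv (\<lambda>y. g y \<bullet> b) y w = dderiv g y w \<bullet> b" if "smooth_on g U" "y \<in> U" for g y w
    using dderiv_eqI[OF has_derivative_inner_left[OF smooth_on_has_derivative[OF that]]] by simp
  have 2: "dderiv (\<lambda>y. dderiv (\<lambda>y. f y \<bullet> b) y w) p z = dderiv (\<lambda>y. dderiv f y w) p z \<bullet> b" for w z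
  proof -
    have "((\<lambda>y. dderiv f y w \<bullet> b) has_derivative (\<lambda>z. dderiv (\<lambda>y. dderiv f y w) p z \<bullet> b)) (at p)"
      by (intro has_derivative_inner_left smooth_on_has_derivative smooth_on_dderiv_fixed) fact+
    then have "((\<lambda>y. dderiv (\<lambda>y. f y \<bullet> b) y w) has_derivative
        (\<lambda>z. dderiv (\<lambda>y. dderiv f y w) p z \<bullet> b)) (at p)"
      by (rule has_derivative_transform_within_open) (use assms 1 in auto)
    then show ?thesis by (simp add: dderiv_eqI)
  qed
  have "smooth_on (\<lambda>y. f y \<bullet> b) U"
    by (intro smooth_on_inner smooth_on_const assms)
  then show "dderiv (\<lambda>y. dderiv f y u) p v \<bullet> b = dderiv (\<lambda>y. dderiv f y v) p u \<bullet> b"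
    using second_derivative_symmetric_real[of _ U p u v] assms 2 by metis
qed


section \<open>Tangent spaces and differentials\<close>

text \<open>Curves matter only near time 0, so they can be confined to any neighbourhood W of p; this
  makes tangent spaces and differentials local.\<close>

lemma curve_at_nhds:
  assumes "curve_at M p v c" "open W" "p \<in> W"
  obtains \<epsilon> where "\<epsilon> > 0" "smooth_on c {-\<epsilon><..<\<epsilon>}" "c ` {-\<epsilon><..<\<epsilon>} \<subseteq> M \<inter> W"
proof -
  obtain \<epsilon> where \<epsilon>: "\<epsilon> > 0" "smooth_on c {-\<epsilon><..<\<epsilon>}" "c ` {-\<epsilon><..<\<epsilon>} \<subseteq> M"
    using assms(1) by (auto simp: curve_at_def)
  have "isCont c 0" "c 0 = p"
    using assms(1) has_vector_derivative_continuous by (auto simp: curve_at_def)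
  then have "eventually (\<lambda>t. c t \<in> W) (at 0)"
    using assms(2,3) by (auto simp: isCont_def dest: topological_tendstoD)
  then obtain d where d: "d > 0" "\<And>t. t \<noteq> 0 \<Longrightarrow> dist t 0 < d \<Longrightarrow> c t \<in> W"
    by (auto simp: eventually_at)
  have W: "c t \<in> W" if "\<bar>t\<bar> < d" for t
    using d(2)[of t] that \<open>c 0 = p\<close> assms(3) by (cases "t = 0") auto
  show thesis
  proof (rule that[of "min \<epsilon> d"])
    show "smooth_on c {- min \<epsilon> d<..<min \<epsilon> d}"
      by (rule smooth_on_subset[OF \<epsilon>(2)]) auto
    show "c ` {- min \<epsilon> d<..<min \<epsilon> d} \<subseteq> M \<inter> W"
      using \<epsilon>(3) W by force
  qed (use \<epsilon> d in auto)
qed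

lemma curve_at_Int_open:
  assumes "open W" "p \<in> W"
  shows "curve_at (M \<inter> W) p v c \<longleftrightarrow> curve_at M p v c"
proof
  assume "curve_at M p v c"
  moreover from this obtain \<epsilon> where "\<epsilon> > 0" "smooth_on c {-\<epsilon><..<\<epsilon>}" "c ` {-\<epsilon><..<\<epsilon>} \<subseteq> M \<inter> W"
    using curve_at_nhds assms by blast
  ultimately show "curve_at (M \<inter> W) p v c"
    unfolding curve_at_def by blast
qed (auto simp: curve_at_def)

lemma tangent_space_Int_open:
  "open W \<Longrightarrow> p \<in> W \<Longrightarrow> tangent_space (M \<inter> W) p = tangent_space M p"
  by (simp add: tangent_space_def curve_at_Int_open)

lemma mdiff_Int_open: "open W \<Longrightarrow> p \<in> W \<Longrightarrow> mdiff (M \<inter> W) f p v = mdiff M f p v"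
  by (simp add: mdiff_def curve_at_Int_open)

lemma tangent_space_base: "v \<in> tangent_space M p \<Longrightarrow> p \<in> M"
  by (force simp: tangent_space_def curve_at_def)

lemma curve_at_compose_has_vector_derivative:
  assumes "curve_at M p v c" "open U" "p \<in> U" "(F has_derivative F') (at p)"
    and "\<And>x. x \<in> M \<inter> U \<Longrightarrow> F x = f x"
  shows "((f \<circ> c) has_vector_derivative F' v) (at 0)"
proof -
  obtain \<epsilon> where \<epsilon>: "\<epsilon> > 0" "c ` {-\<epsilon><..<\<epsilon>} \<subseteq> M \<inter> U"
    by (rule curve_at_nhds[OF assms(1-3)])
  have "c 0 = p" "(c has_vector_derivative v) (at 0)"
    using assms(1) by (auto simp: curve_at_def)
  then have "((F \<circ> c) has_vector_derivative F' v) (at 0)"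
    using vector_derivative_diff_chain_within[of c v 0 UNIV F F']
      has_derivative_at_withinI[OF assms(4)] by simp
  then show ?thesis
    by (rule has_vector_derivative_transform_within_open[where S = "{-\<epsilon><..<\<epsilon>}"])
      (use \<epsilon> assms(5) in \<open>auto simp: image_subset_iff\<close>)
qed

text \<open>Differentials on M are computed with an arbitrary local extension to the ambient space. That
  v is tangent provides a curve, without which the defining condition on the differential would
  be vacuous.\<close>

lemma mdiff_eqI:
  assumes "v \<in> tangent_space M p" "open U" "p \<in> U" "(F has_derivative F') (at p)"
    and "\<And>x. x \<in> M \<inter> U \<Longrightarrow> F x = f x"
  shows "mdiff M f p v = F' v"
  unfolding mdiff_def
proof (rule the_equality)
  show "\<forall>c. curve_at M p v c \<longrightarrow> ((f \<circ> c) has_vector_derivative F' v) (at 0)"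
    using curve_at_compose_has_vector_derivative[OF _ assms(2-5)] by blast
next
  fix d assume d: "\<forall>c. curve_at M p v c \<longrightarrow> ((f \<circ> c) has_vector_derivative d) (at 0)"
  obtain c where "curve_at M p v c"
    using assms(1) by (auto simp: tangent_space_def)
  then show "d = F' v"
    using d curve_at_compose_has_vector_derivative[OF _ assms(2-5)]
    by (blast intro: vector_derivative_unique_at)
qed

lemma mdiff_id: "v \<in> tangent_space M p \<Longrightarrow> mdiff M (\<lambda>x. x) p v = v"
  by (rule mdiff_eqI[of _ _ _ UNIV]) auto

lemma mdiff_cong:
  assumes "\<And>x. x \<in> M \<Longrightarrow> f x = g x"
  shows "mdiff M f p v = mdiff M g p v"
proof -
  have "((f \<circ> c) has_vector_derivative d) (at 0) \<longleftrightarrow> ((g \<circ> c) has_vector_derivative d) (at 0)"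
    if c: "curve_at M p v c" for c d
  proof -
    obtain \<epsilon> where \<epsilon>: "\<epsilon> > 0" "c ` {-\<epsilon><..<\<epsilon>} \<subseteq> M \<inter> UNIV"
      using curve_at_nhds[OF c open_UNIV UNIV_I] by metis
    have eq: "(f \<circ> c) t = (g \<circ> c) t" if "t \<in> {-\<epsilon><..<\<epsilon>}" for t
      using that assms \<epsilon>(2) by (simp add: image_subset_iff)
    have nb: "open {-\<epsilon><..<\<epsilon>}" "0 \<in> {-\<epsilon><..<\<epsilon>}"
      using \<epsilon>(1) by auto
    show ?thesis
    proof
      assume "((f \<circ> c) has_vector_derivative d) (at 0)"
      then show "((g \<circ> c) has_vector_derivative d) (at 0)"
        by (rule has_vector_derivative_transform_within_open[OF _ nb]) (rule eq)
    next
      assume "((g \<circ> c) has_vector_derivative d) (at 0)"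
      then show "((f \<circ> c) has_vector_derivative d) (at 0)"
        by (rule has_vector_derivative_transform_within_open[OF _ nb]) (rule eq[symmetric])
    qed
  qed
  then have "(\<forall>c. curve_at M p v c \<longrightarrow> ((f \<circ> c) has_vector_derivative d) (at 0)) \<longleftrightarrow>
      (\<forall>c. curve_at M p v c \<longrightarrow> ((g \<circ> c) has_vector_derivative d) (at 0))" for d
    by blast
  then show ?thesis unfolding mdiff_def by simp
qed

lemma tangent_space_image:
  fixes G :: "'a::euclidean_space \<Rightarrow> 'b::euclidean_space"
  assumes "v \<in> tangent_space M p" "smooth_on G U" "open U" "p \<in> U"
    and "\<And>x. x \<in> M \<inter> U \<Longrightarrow> G x \<in> N"
  shows "dderiv G p v \<in> tangent_space N (G p)"
proof -
  obtain c where c: "curve_at M p v c"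
    using assms(1) by (auto simp: tangent_space_def)
  obtain \<epsilon> where \<epsilon>: "\<epsilon> > 0" "smooth_on c {-\<epsilon><..<\<epsilon>}" "c ` {-\<epsilon><..<\<epsilon>} \<subseteq> M \<inter> U"
    using curve_at_nhds[OF c assms(3,4)] by blast
  have "((G \<circ> c) has_vector_derivative dderiv G p v) (at 0)"
    by (rule curve_at_compose_has_vector_derivative[OF c assms(3,4)])
      (use smooth_on_has_derivative[OF assms(2,4)] in auto)
  moreover have "smooth_on (\<lambda>t. G (c t)) {-\<epsilon><..<\<epsilon>}"
    by (rule smooth_on_compose[OF assms(2) \<epsilon>(2)]) (use \<epsilon>(3) assms(3) in auto)
  moreover have "(G \<circ> c) ` {-\<epsilon><..<\<epsilon>} \<subseteq> N"
    using \<epsilon>(3) assms(5) by auto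
  ultimately have "curve_at N (G p) (dderiv G p v) (G \<circ> c)"
    using \<epsilon>(1) c by (auto simp: curve_at_def o_def)
  then show ?thesis by (auto simp: tangent_space_def)
qed

lemma tangent_space_UNIV: "tangent_space UNIV p = UNIV"
proof -
  have "curve_at UNIV p v (\<lambda>t. p + t *\<^sub>R v)" for v
  proof -
    have "smooth_on (\<lambda>t::real. p + t *\<^sub>R v) {-1<..<1}"
      by (intro smooth_on_add smooth_on_const smooth_on_scaleR smooth_on_ident) auto
    moreover have "((\<lambda>t. p + t *\<^sub>R v) has_vector_derivative v) (at 0)"
      by (auto intro!: derivative_eq_intros)
    ultimately show ?thesis
      by (auto simp: curve_at_def intro!: exI[of _ 1])
  qed
  then show ?thesis by (auto simp: tangent_space_def)
qed

lemma tangent_space_open: "open U \<Longrightarrow> p \<in> U \<Longrightarrow> tangent_space U p = UNIV"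
  using tangent_space_Int_open[of U p UNIV] tangent_space_UNIV by auto


section \<open>Smooth functions on a subset\<close>

lemma smooth_fun_cong: "smooth_fun M f \<Longrightarrow> (\<And>x. x \<in> M \<Longrightarrow> f x = g x) \<Longrightarrow> smooth_fun M g"
  unfolding smooth_fun_def by (metis IntD1)

lemma smooth_fun_local_extension:
  assumes "smooth_fun M f" "p \<in> M"
  obtains U F where "open U" "p \<in> U" "smooth_on F U" "\<And>x. x \<in> M \<inter> U \<Longrightarrow> F x = f x"
  using assms unfolding smooth_fun_def by metis

lemma mdiff_extension:
  assumes "open U" "smooth_on F U" "\<And>x. x \<in> M \<inter> U \<Longrightarrow> F x = f x"
    "p \<in> U" "v \<in> tangent_space M p"
  shows "mdiff M f p v = dderiv F p v"
  by (rule mdiff_eqI[OF assms(5,1,4) smooth_on_has_derivative[OF assms(2,4)] assms(3)])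

lemma smooth_fun_local_extensions:
  assumes "smooth_fun M f" "smooth_fun M g" "p \<in> M"
  obtains U F G where "open U" "p \<in> U" "smooth_on F U" "smooth_on G U"
    "\<And>x. x \<in> M \<inter> U \<Longrightarrow> F x = f x" "\<And>x. x \<in> M \<inter> U \<Longrightarrow> G x = g x"
proof -
  obtain U F where 1: "open U" "p \<in> U" "smooth_on F U" "\<And>x. x \<in> M \<inter> U \<Longrightarrow> F x = f x"
    using smooth_fun_local_extension[OF assms(1,3)] by metis
  obtain V G where 2: "open V" "p \<in> V" "smooth_on G V" "\<And>x. x \<in> M \<inter> V \<Longrightarrow> G x = g x"
    using smooth_fun_local_extension[OF assms(2,3)] by metis
  show thesis
    by (rule that[of "U \<inter> V" F G]) (use 1 2 in \<open>auto intro: smooth_on_subset\<close>)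
qed

lemma smooth_fun_const: "smooth_fun M (\<lambda>x. c)"
  unfolding smooth_fun_def by (auto intro!: exI[of _ UNIV] exI[of _ "\<lambda>x. c"] smooth_on_const)

lemma smooth_fun_ident: "smooth_fun M (\<lambda>x. x)"
  unfolding smooth_fun_def by (auto intro!: exI[of _ UNIV] exI[of _ "\<lambda>x. x"] smooth_on_ident)

lemma smooth_fun_linear:
  fixes f :: "'a::euclidean_space \<Rightarrow> 'b::real_normed_vector"
  shows "bounded_linear f \<Longrightarrow> smooth_fun M f"
  unfolding smooth_fun_def by (auto intro!: exI[of _ UNIV] exI[of _ f] smooth_on_linear)

lemma
  assumes "bounded_bilinear B" "smooth_fun M f" "smooth_fun M g"
  shows smooth_fun_bilinear: "smooth_fun M (\<lambda>x. B (f x) (g x))"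
    and mdiff_bilinear: "v \<in> tangent_space M p \<Longrightarrow>
      mdiff M (\<lambda>x. B (f x) (g x)) p v = B (f p) (mdiff M g p v) + B (mdiff M f p v) (g p)"
proof -
  have "\<exists>U F. open U \<and> p \<in> U \<and> smooth_on F U \<and> (\<forall>x\<in>M \<inter> U. F x = B (f x) (g x)) \<and>
    (\<forall>v \<in> tangent_space M p. dderiv F p v = B (f p) (mdiff M g p v) + B (mdiff M f p v) (g p))"
    if "p \<in> M" for p
  proof -
    obtain U F G where U: "open U" "p \<in> U" "smooth_on F U" "smooth_on G U"
      "\<And>x. x \<in> M \<inter> U \<Longrightarrow> F x = f x" "\<And>x. x \<in> M \<inter> U \<Longrightarrow> G x = g x"
      using smooth_fun_local_extensions[OF assms(2,3) \<open>p \<in> M\<close>] by metis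
    have D: "dderiv (\<lambda>x. B (F x) (G x)) p = (\<lambda>v. B (F p) (dderiv G p v) + B (dderiv F p v) (G p))"
      using U by (intro dderiv_eqI bounded_bilinear.FDERIV[OF assms(1)] smooth_on_has_derivative)
    have "mdiff M g p v = dderiv G p v" "mdiff M f p v = dderiv F p v"
      if "v \<in> tangent_space M p" for v
      using mdiff_extension[OF U(1,3,5,2) that] mdiff_extension[OF U(1,4,6,2) that] by auto
    moreover have "smooth_on (\<lambda>x. B (F x) (G x)) U"
      using U smooth_on_bilinear[OF assms(1)] by blast
    ultimately show ?thesis
      using U \<open>p \<in> M\<close> by (intro exI[of _ U] exI[of _ "\<lambda>x. B (F x) (G x)"]) (auto simp: D)
  qed
  note ext = this
  then show "smooth_fun M (\<lambda>x. B (f x) (g x))"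
    unfolding smooth_fun_def by metis
  assume v: "v \<in> tangent_space M p"
  then obtain U F where "open U" "p \<in> U" "smooth_on F U" "\<And>x. x \<in> M \<inter> U \<Longrightarrow> F x = B (f x) (g x)"
    "dderiv F p v = B (f p) (mdiff M g p v) + B (mdiff M f p v) (g p)"
    using ext[OF tangent_space_base[OF v]] by blast
  then show "mdiff M (\<lambda>x. B (f x) (g x)) p v = B (f p) (mdiff M g p v) + B (mdiff M f p v) (g p)"
    using mdiff_extension[of U F M _ p v] v by metis
qed

lemma
  assumes "smooth_fun M f" "smooth_fun M g"
  shows smooth_fun_add: "smooth_fun M (\<lambda>x. f x + g x)"
    and mdiff_add: "v \<in> tangent_space M p \<Longrightarrow>
      mdiff M (\<lambda>x. f x + g x) p v = mdiff M f p v + mdiff M g p v"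
proof -
  show "smooth_fun M (\<lambda>x. f x + g x)"
    unfolding smooth_fun_def
  proof
    fix p assume "p \<in> M"
    then obtain U F G where U: "open U" "p \<in> U" "smooth_on F U" "smooth_on G U"
      "\<And>x. x \<in> M \<inter> U \<Longrightarrow> F x = f x" "\<And>x. x \<in> M \<inter> U \<Longrightarrow> G x = g x"
      using smooth_fun_local_extensions[OF assms] by metis
    then show "\<exists>U F. open U \<and> p \<in> U \<and> smooth_on F U \<and> (\<forall>x\<in>M \<inter> U. F x = f x + g x)"
      by (intro exI[of _ U] exI[of _ "\<lambda>x. F x + G x"]) (auto intro: smooth_on_add)
  qed
  assume v: "v \<in> tangent_space M p"
  obtain U F G where U: "open U" "p \<in> U" "smooth_on F U" "smooth_on G U"
      "\<And>x. x \<in> M \<inter> U \<Longrightarrow> F x = f x" "\<And>x. x \<in> M \<inter> U \<Longrightarrow> G x = g x"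
    using smooth_fun_local_extensions[OF assms tangent_space_base[OF v]] by metis
  have "mdiff M (\<lambda>x. f x + g x) p v = dderiv F p v + dderiv G p v"
    by (rule mdiff_eqI[OF v U(1,2)
          has_derivative_add[OF smooth_on_has_derivative[OF U(3,2)] smooth_on_has_derivative[OF U(4,2)]]])
      (use U(5,6) in simp)
  then show "mdiff M (\<lambda>x. f x + g x) p v = mdiff M f p v + mdiff M g p v"
    using mdiff_extension[OF U(1,3,5,2) v] mdiff_extension[OF U(1,4,6,2) v] by simp
qed

lemma mdiff_const: "v \<in> tangent_space M p \<Longrightarrow> mdiff M (\<lambda>x. c) p v = 0"
  by (rule mdiff_eqI[of _ _ _ UNIV]) auto

lemmas smooth_fun_scaleR = smooth_fun_bilinear[OF bounded_bilinear_scaleR]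
lemmas smooth_fun_inner = smooth_fun_bilinear[OF bounded_bilinear_inner]
lemmas mdiff_inner = mdiff_bilinear[OF bounded_bilinear_inner]

lemma mdiff_scaleR_const:
  assumes "smooth_fun M f" "v \<in> tangent_space M p"
  shows "mdiff M (\<lambda>x. c *\<^sub>R f x) p v = c *\<^sub>R mdiff M f p v"
  using mdiff_bilinear[OF bounded_bilinear_scaleR smooth_fun_const assms(1) assms(2), of c]
  by (simp add: mdiff_const[OF assms(2)])

lemma smooth_fun_diff:
  assumes "smooth_fun M f" "smooth_fun M g"
  shows "smooth_fun M (\<lambda>x. f x - g x)"
  using smooth_fun_add[OF assms(1) smooth_fun_scaleR[OF smooth_fun_const assms(2), of "-1"]]
  by simp

lemma mdiff_diff:
  assumes "smooth_fun M f" "smooth_fun M g" "v \<in> tangent_space M p"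
  shows "mdiff M (\<lambda>x. f x - g x) p v = mdiff M f p v - mdiff M g p v"
  using mdiff_add[OF assms(1) smooth_fun_scaleR[OF smooth_fun_const assms(2), of "-1"] assms(3)]
    mdiff_scaleR_const[OF assms(2,3), of "-1"]
  by simp

text \<open>Linearity in the vector is inherited from the derivative of a local extension; curves alone
  would not give it, as they cannot be added.\<close>

lemma mdiff_linear:
  assumes "subspace (tangent_space M p)" "smooth_fun M f"
    "u \<in> tangent_space M p"
  shows "v \<in> tangent_space M p \<Longrightarrow> mdiff M f p (u + v) = mdiff M f p u + mdiff M f p v"
    and "mdiff M f p (c *\<^sub>R u) = c *\<^sub>R mdiff M f p u"
proof -
  obtain U F where U: "open U" "p \<in> U" "smooth_on F U" "\<And>x. x \<in> M \<inter> U \<Longrightarrow> F x = f x"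
    using smooth_fun_local_extension[OF assms(2) tangent_space_base[OF assms(3)]] by metis
  have D: "mdiff M f p w = dderiv F p w" if "w \<in> tangent_space M p" for w
    by (rule mdiff_extension[OF U(1,3,4,2) that])
  have lin: "linear (dderiv F p)"
    using U smooth_on_differentiable linear_frechet_derivative by blast
  show "mdiff M f p (u + v) = mdiff M f p u + mdiff M f p v" if "v \<in> tangent_space M p"
    using D assms(3) that subspace_add[OF assms(1,3) that] by (simp add: linear_add[OF lin])
  show "mdiff M f p (c *\<^sub>R u) = c *\<^sub>R mdiff M f p u"
    using D assms(3) subspace_scale[OF assms(1,3), of c] by (simp add: linear_cmul[OF lin])
qed

lemma vector_fieldsD:
  assumes "X \<in> vector_fields M"
  shows "smooth_fun M X" "p \<in> M \<Longrightarrow> X p \<in> tangent_space M p" "p \<notin> M \<Longrightarrow> X p = 0"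
  using assms by (auto simp: vector_fields_def)

lemma smooth_fun_mdiff:
  assumes "smooth_fun M f" "X \<in> vector_fields M"
  shows "smooth_fun M (\<lambda>q. mdiff M f q (X q))"
  unfolding smooth_fun_def
proof
  fix p assume p: "p \<in> M"
  obtain U F Y where U: "open U" "p \<in> U" "smooth_on F U" "smooth_on Y U"
    "\<And>x. x \<in> M \<inter> U \<Longrightarrow> F x = f x" "\<And>x. x \<in> M \<inter> U \<Longrightarrow> Y x = X x"
    using smooth_fun_local_extensions[OF assms(1) vector_fieldsD(1)[OF assms(2)] p] by metis
  have "dderiv F x (Y x) = mdiff M f x (X x)" if "x \<in> M \<inter> U" for x
    using that mdiff_extension[OF U(1,3,5), where p = x and v = "X x"] U(6) vector_fieldsD(2)[OF assms(2)]
    by auto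
  moreover have "smooth_on (\<lambda>x. dderiv F x (Y x)) U"
    using smooth_on_dderiv[OF U(3) smooth_on_ident[OF U(1)] _ U(4)] U(1) by simp
  ultimately show "\<exists>U G. open U \<and> p \<in> U \<and> smooth_on G U \<and> (\<forall>x\<in>M \<inter> U. G x = mdiff M f x (X x))"
    using U(1,2) by blast
qed


section \<open>Submanifolds as local smooth retracts\<close>

text \<open>The image of a smooth retraction of an open set is a submanifold, and every submanifold is
  locally of this kind. A retraction serves better here than charts do: composing with it extends
  functions from the submanifold to an open set, its derivative projects onto the tangent spaces
  and extends tangent vectors to vector fields, and the map \<open>(x, w) \<mapsto> (r x, Dr(x) w)\<close> is again
  a retraction, onto the tangent bundle.\<close>

definition smooth_retraction :: "'a::euclidean_space set \<Rightarrow> 'a set \<Rightarrow> ('a \<Rightarrow> 'a) \<Rightarrow> bool"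
  where "smooth_retraction M U r \<longleftrightarrow>
    open U \<and> smooth_on r U \<and> r ` U \<subseteq> M \<inter> U \<and> (\<forall>x\<in>M \<inter> U. r x = x)"

definition submanifold :: "'a::euclidean_space set \<Rightarrow> bool"
  where "submanifold M \<longleftrightarrow> (\<forall>p\<in>M. \<exists>U r. p \<in> U \<and> smooth_retraction M U r)"

lemma smooth_retractionD:
  assumes "smooth_retraction M U r"
  shows "open U" "smooth_on r U" "x \<in> U \<Longrightarrow> r x \<in> M" "x \<in> U \<Longrightarrow> r x \<in> U"
    "x \<in> M \<Longrightarrow> x \<in> U \<Longrightarrow> r x = x"
  using assms by (auto simp: smooth_retraction_def)

lemma submanifoldE:
  assumes "submanifold M" "p \<in> M"
  obtains U r where "p \<in> U" "smooth_retraction M U r"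
  using assms by (auto simp: submanifold_def)

lemma submanifold_Int_open:
  assumes "submanifold M" "open W"
  shows "submanifold (M \<inter> W)"
  unfolding submanifold_def
proof
  fix p assume p: "p \<in> M \<inter> W"
  then obtain U r where U: "p \<in> U" "smooth_retraction M U r"
    using assms(1) submanifoldE by blast
  note r = smooth_retractionD[OF U(2)]
  \<comment> \<open>Removing from the domain the points that leave W keeps it invariant, as \<open>r (r x) = r x\<close>.\<close>
  define U' where "U' = U \<inter> W \<inter> {x\<in>U. r x \<in> W}"
  have "{x\<in>U. r x \<in> W} = r -` W \<inter> U" by auto
  then have "open {x\<in>U. r x \<in> W}"
    using continuous_on_open_vimage[OF r(1)] smooth_on_continuous[OF r(2)] assms(2) by metis
  then have "open U'"
    using r(1) assms(2) by (auto simp: U'_def)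
  moreover have "smooth_on r U'"
    using r(2) by (rule smooth_on_subset) (auto simp: U'_def)
  ultimately have "smooth_retraction (M \<inter> W) U' r"
    using r by (auto simp: smooth_retraction_def U'_def)
  moreover have "p \<in> U'"
    using p U r by (auto simp: U'_def)
  ultimately show "\<exists>U r. p \<in> U \<and> smooth_retraction (M \<inter> W) U r" by blast
qed

text \<open>The retraction maps straight lines in U to curves in M.\<close>

lemma dderiv_retraction_tangent:
  assumes "smooth_retraction M U r" "x \<in> U"
  shows "dderiv r x v \<in> tangent_space M (r x)"
  using tangent_space_image[of v U x r U M] smooth_retractionD[OF assms(1)] assms(2)
    tangent_space_open by blast

text \<open>Along M the retraction and the identity of the ambient space both extend the identity of M,
  so their derivatives agree on tangent vectors.\<close>

lemma tangent_space_retraction: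
  assumes "smooth_retraction M U r" "p \<in> M" "p \<in> U"
  shows "tangent_space M p = {v. dderiv r p v = v}"
proof -
  note r = smooth_retractionD[OF assms(1)]
  have "dderiv r p v = v" if "v \<in> tangent_space M p" for v
  proof -
    have "mdiff M (\<lambda>x. x) p v = dderiv r p v"
      by (rule mdiff_eqI[OF that r(1) assms(3) smooth_on_has_derivative[OF r(2) assms(3)]])
        (use r in auto)
    then show ?thesis using mdiff_id[OF that] by simp
  qed
  moreover have "v \<in> tangent_space M p" if "dderiv r p v = v" for v
    using dderiv_retraction_tangent[OF assms(1,3), of v] that r(5)[OF assms(2,3)] by simp
  ultimately show ?thesis by blast
qed

text \<open>The fixed space of a linear map is a subspace.\<close>

lemma subspace_tangent_space:
  assumes "submanifold M" "p \<in> M"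
  shows "subspace (tangent_space M p)"
proof -
  obtain U r where U: "p \<in> U" "smooth_retraction M U r"
    using submanifoldE[OF assms] by blast
  then have "linear (dderiv r p)"
    using smooth_retractionD smooth_on_differentiable linear_frechet_derivative by metis
  then show ?thesis
    unfolding tangent_space_retraction[OF U(2) assms(2) U(1)]
    by (auto simp: subspace_def linear_add linear_cmul linear_0)
qed

text \<open>The derivatives of the retraction project the constant field v to tangent vectors, all along
  \<open>M \<inter> U\<close>.\<close>

lemma tangent_vector_extension:
  assumes "smooth_retraction M U r" "p \<in> M" "p \<in> U" "v \<in> tangent_space M p"
  obtains X where "X \<in> vector_fields (M \<inter> U)" "X p = v"
proof -
  note r = smooth_retractionD[OF assms(1)]
  define X where "X = (\<lambda>x. if x \<in> M \<inter> U then dderiv r x v else 0)"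
  have "smooth_fun (M \<inter> U) X"
    unfolding smooth_fun_def using r(1) smooth_on_dderiv_fixed[OF r(2), of v]
    by (intro ballI exI[of _ U] exI[of _ "\<lambda>x. dderiv r x v"]) (auto simp: X_def)
  moreover have "X x \<in> tangent_space (M \<inter> U) x" if "x \<in> M \<inter> U" for x
    using dderiv_retraction_tangent[OF assms(1), of x v] that r(1,5)
    by (auto simp: X_def tangent_space_Int_open)
  ultimately have "X \<in> vector_fields (M \<inter> U)"
    by (auto simp: vector_fields_def X_def)
  moreover have "X p = v"
    using assms tangent_space_retraction[OF assms(1-3)] by (auto simp: X_def)
  ultimately show thesis by (rule that)
qed


section \<open>The Lie algebra of vector fields\<close>

text \<open>The product rule for \<open>DF(Y)\<close>: one term differentiates \<open>DF\<close> with the vector \<open>Y(p)\<close> held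
  fixed, the other differentiates Y.\<close>

lemma has_derivative_dderiv:
  fixes F :: "'a::euclidean_space \<Rightarrow> 'b::real_normed_vector"
  assumes F: "smooth_on F U" and "open U" "p \<in> U" and Y: "(Y has_derivative Y') (at p)"
  shows "((\<lambda>x. dderiv F x (Y x)) has_derivative
    (\<lambda>u. dderiv (\<lambda>x. dderiv F x (Y p)) p u + dderiv F p (Y' u))) (at p)"
proof -
  have D: "((\<lambda>x. dderiv F x b) has_derivative dderiv (\<lambda>x. dderiv F x b) p) (at p)" for b
    using smooth_on_has_derivative[OF smooth_on_dderiv_fixed[OF F] \<open>p \<in> U\<close>] .
  have expand: "(\<Sum>b\<in>Basis. (v \<bullet> b) *\<^sub>R dderiv F x b) = dderiv F x v" if "x \<in> U" for x v
    using dderiv_basis_expansion smooth_on_differentiable[OF F that] by metis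
  have "((\<lambda>x. \<Sum>b\<in>Basis. (Y x \<bullet> b) *\<^sub>R dderiv F x b) has_derivative
      (\<lambda>u. \<Sum>b\<in>Basis. (Y p \<bullet> b) *\<^sub>R dderiv (\<lambda>x. dderiv F x b) p u + (Y' u \<bullet> b) *\<^sub>R dderiv F p b)) (at p)"
    by (intro has_derivative_sum has_derivative_scaleR has_derivative_inner_left Y D)
  moreover have "((\<lambda>x. \<Sum>b\<in>Basis. (Y p \<bullet> b) *\<^sub>R dderiv F x b) has_derivative
      (\<lambda>u. \<Sum>b\<in>Basis. (Y p \<bullet> b) *\<^sub>R dderiv (\<lambda>x. dderiv F x b) p u)) (at p)"
    by (intro has_derivative_sum has_derivative_scaleR_right D)
  then have "((\<lambda>x. dderiv F x (Y p)) has_derivative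
      (\<lambda>u. \<Sum>b\<in>Basis. (Y p \<bullet> b) *\<^sub>R dderiv (\<lambda>x. dderiv F x b) p u)) (at p)"
    by (rule has_derivative_transform_within_open[OF _ assms(2,3)]) (rule expand)
  then have "(\<Sum>b\<in>Basis. (Y p \<bullet> b) *\<^sub>R dderiv (\<lambda>x. dderiv F x b) p u) =
      dderiv (\<lambda>x. dderiv F x (Y p)) p u" for u
    by (simp add: dderiv_eqI)
  ultimately have "((\<lambda>x. \<Sum>b\<in>Basis. (Y x \<bullet> b) *\<^sub>R dderiv F x b) has_derivative
      (\<lambda>u. dderiv (\<lambda>x. dderiv F x (Y p)) p u + dderiv F p (Y' u))) (at p)"
    by (simp add: sum.distrib expand[OF \<open>p \<in> U\<close>])
  then show ?thesis
    by (rule has_derivative_transform_within_open[OF _ assms(2,3)]) (rule expand)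
qed

text \<open>In terms of local extensions, \<open>X (Y f) = D\<^sup>2F(Y, X) + DF(DY X)\<close>; in the commutator the
  second derivatives cancel, being symmetric.\<close>

lemma commutator_extension:
  fixes F :: "'a::euclidean_space \<Rightarrow> 'b::euclidean_space"
  assumes X: "X \<in> vector_fields M" and Y: "Y \<in> vector_fields M" and p: "p \<in> M" "p \<in> U"
    and F: "open U" "smooth_on F U" "\<And>x. x \<in> M \<inter> U \<Longrightarrow> F x = f x"
  shows "mdiff M (\<lambda>q. mdiff M f q (Y q)) p (X p) - mdiff M (\<lambda>q. mdiff M f q (X q)) p (Y p) =
    dderiv F p (mdiff M Y p (X p) - mdiff M X p (Y p))"
proof -
  have *: "mdiff M (\<lambda>q. mdiff M f q (Z q)) p w =
      dderiv (\<lambda>x. dderiv F x (Z p)) p w + dderiv F p (mdiff M Z p w)"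
    if Z: "Z \<in> vector_fields M" and w: "w \<in> tangent_space M p" for Z w
  proof -
    obtain V G where V: "open V" "p \<in> V" "smooth_on G V" "\<And>x. x \<in> M \<inter> V \<Longrightarrow> G x = Z x"
      using smooth_fun_local_extension[OF vector_fieldsD(1)[OF Z] p(1)] by metis
    have "mdiff M (\<lambda>q. mdiff M f q (Z q)) p w =
        dderiv (\<lambda>x. dderiv F x (G p)) p w + dderiv F p (dderiv G p w)"
    proof (rule mdiff_eqI[OF w])
      show "open (U \<inter> V)" "p \<in> U \<inter> V"
        using V F p by auto
      show "((\<lambda>x. dderiv F x (G x)) has_derivative
          (\<lambda>w. dderiv (\<lambda>x. dderiv F x (G p)) p w + dderiv F p (dderiv G p w))) (at p)"
        by (rule has_derivative_dderiv[OF F(2,1) p(2) smooth_on_has_derivative[OF V(3,2)]])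
      show "dderiv F x (G x) = mdiff M f x (Z x)" if "x \<in> M \<inter> (U \<inter> V)" for x
        using that mdiff_extension[OF F(1,2,3), where p = x and v = "Z x"]
          V(4)[of x] vector_fieldsD(2)[OF Z] by auto
    qed
    then show ?thesis
      using mdiff_extension[OF V(1,3,4,2) w] V(2,4) p(1) by simp
  qed
  have "linear (dderiv F p)"
    using smooth_on_differentiable[OF F(2) p(2)] by (rule linear_frechet_derivative)
  then show ?thesis
    using *[OF Y vector_fieldsD(2)[OF X p(1)]] *[OF X vector_fieldsD(2)[OF Y p(1)]]
      second_derivative_symmetric[OF F(2,1) p(2), of "Y p" "X p"]
    by (simp add: linear_diff)
qed

text \<open>A retraction extends the identity of the submanifold, so the previous lemma says that its
  derivative fixes \<open>DY X - DX Y\<close>.\<close>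

lemma commutator_tangent:
  assumes "submanifold M" "X \<in> vector_fields M" "Y \<in> vector_fields M" "p \<in> M"
  shows "mdiff M Y p (X p) - mdiff M X p (Y p) \<in> tangent_space M p"
proof -
  obtain U r where U: "p \<in> U" "smooth_retraction M U r"
    by (rule submanifoldE[OF assms(1,4)])
  note r = smooth_retractionD[OF U(2)]
  have id: "mdiff M (\<lambda>q. mdiff M (\<lambda>x. x) q (Z q)) p w = mdiff M Z p w"
    if "Z \<in> vector_fields M" for Z w
    using that by (intro mdiff_cong mdiff_id vector_fieldsD)
  have "mdiff M Y p (X p) - mdiff M X p (Y p) = dderiv r p (mdiff M Y p (X p) - mdiff M X p (Y p))"
    using commutator_extension[OF assms(2-4) U(1) r(1,2), of "\<lambda>x. x"] r(5) id assms(2,3) by simp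
  then show ?thesis
    using tangent_space_retraction[OF U(2) assms(4) U(1)] by simp
qed

lemma commutator_mdiff:
  fixes f :: "'a::euclidean_space \<Rightarrow> 'b::euclidean_space"
  assumes "submanifold M" "X \<in> vector_fields M" "Y \<in> vector_fields M" "p \<in> M" "smooth_fun M f"
  shows "mdiff M (\<lambda>q. mdiff M f q (Y q)) p (X p) - mdiff M (\<lambda>q. mdiff M f q (X q)) p (Y p) =
    mdiff M f p (mdiff M Y p (X p) - mdiff M X p (Y p))"
proof -
  obtain U F where U: "open U" "p \<in> U" "smooth_on F U" "\<And>x. x \<in> M \<inter> U \<Longrightarrow> F x = f x"
    using smooth_fun_local_extension[OF assms(5,4)] by metis
  show ?thesis
    using commutator_extension[OF assms(2-4) U(2,1,3,4)]
      mdiff_extension[OF U(1,3,4,2) commutator_tangent[OF assms(1-4)]] by simp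
qed

text \<open>A tangent vector is determined by its action on the restrictions of linear functions, so the
  description of the bracket as a commutator of derivations picks out one vector.\<close>

lemma lie_bracket_eq:
  assumes "submanifold M" "X \<in> vector_fields M" "Y \<in> vector_fields M" "p \<in> M"
  shows "lie_bracket M X Y p = mdiff M Y p (X p) - mdiff M X p (Y p)" (is "_ = ?v")
proof -
  have "(THE v. v \<in> tangent_space M p \<and> (\<forall>f::'a \<Rightarrow> real. smooth_fun M f \<longrightarrow>
      mdiff M f p v = mdiff M (\<lambda>q. mdiff M f q (Y q)) p (X p) -
        mdiff M (\<lambda>q. mdiff M f q (X q)) p (Y p))) = ?v"
  proof (rule the_equality)
    show "?v \<in> tangent_space M p \<and> (\<forall>f::'a \<Rightarrow> real. smooth_fun M f \<longrightarrow>
      mdiff M f p ?v = mdiff M (\<lambda>q. mdiff M f q (Y q)) p (X p) -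
        mdiff M (\<lambda>q. mdiff M f q (X q)) p (Y p))"
      using commutator_tangent[OF assms] commutator_mdiff[OF assms, of "f :: 'a \<Rightarrow> real" for f]
      by simp
  next
    fix v assume v: "v \<in> tangent_space M p \<and> (\<forall>f::'a \<Rightarrow> real. smooth_fun M f \<longrightarrow>
      mdiff M f p v = mdiff M (\<lambda>q. mdiff M f q (Y q)) p (X p) -
        mdiff M (\<lambda>q. mdiff M f q (X q)) p (Y p))"
    have lin: "mdiff M (\<lambda>x. x \<bullet> b) p w = w \<bullet> b" if "w \<in> tangent_space M p" for w b
      by (rule mdiff_eqI[OF that open_UNIV UNIV_I]) (auto intro!: derivative_eq_intros)
    have smooth: "smooth_fun M (\<lambda>x. x \<bullet> b)" for b
      by (intro smooth_fun_inner smooth_fun_ident smooth_fun_const)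
    have "v \<bullet> b = ?v \<bullet> b" for b
      using v smooth[of b] lin commutator_tangent[OF assms] commutator_mdiff[OF assms smooth[of b]]
      by metis
    then show "v = ?v"
      using vector_eq_rdot by blast
  qed
  then show ?thesis
    using assms(4) by (simp add: lie_bracket_def)
qed

lemma lie_bracket_outside: "p \<notin> M \<Longrightarrow> lie_bracket M X Y p = 0"
  by (simp add: lie_bracket_def)

lemma lie_bracket_vector_fields:
  assumes "submanifold M" "X \<in> vector_fields M" "Y \<in> vector_fields M"
  shows "lie_bracket M X Y \<in> vector_fields M"
proof -
  have "smooth_fun M (\<lambda>p. mdiff M Y p (X p) - mdiff M X p (Y p))"
    using assms by (intro smooth_fun_diff smooth_fun_mdiff vector_fieldsD)
  then have "smooth_fun M (lie_bracket M X Y)"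
    by (rule smooth_fun_cong) (simp add: lie_bracket_eq[OF assms])
  then show ?thesis
    using commutator_tangent[OF assms]
    by (simp add: vector_fields_def lie_bracket_eq[OF assms] lie_bracket_outside)
qed

lemma subspace_vector_fields:
  assumes "submanifold M"
  shows "subspace (vector_fields M)"
  unfolding subspace_def
proof (intro conjI ballI allI)
  show "0 \<in> vector_fields M"
    using subspace_0[OF subspace_tangent_space[OF assms]] smooth_fun_const[of M 0]
    by (simp add: vector_fields_def zero_fun_def)
next
  fix X Y assume "X \<in> vector_fields M" "Y \<in> vector_fields M"
  then show "X + Y \<in> vector_fields M"
    using subspace_add[OF subspace_tangent_space[OF assms]] smooth_fun_add[of M X Y]
    by (simp add: vector_fields_def plus_fun_def)
next
  fix c X assume "X \<in> vector_fields M"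
  then show "c *\<^sub>R X \<in> vector_fields M"
    using subspace_scale[OF subspace_tangent_space[OF assms]]
      smooth_fun_scaleR[OF smooth_fun_const, of M X c]
    by (simp add: vector_fields_def scaleR_fun_def)
qed

lemma lie_algebra_vector_fields:
  assumes M: "submanifold M"
  shows "lie_algebra (vector_fields M) (lie_bracket M)"
proof -
  note sub = subspace_vector_fields[OF M]
  note T = subspace_tangent_space[OF M]
  have add: "lie_bracket M (X + Y) Z = lie_bracket M X Z + lie_bracket M Y Z"
    and add': "lie_bracket M Z (X + Y) = lie_bracket M Z X + lie_bracket M Z Y"
    if V: "X \<in> vector_fields M" "Y \<in> vector_fields M" "Z \<in> vector_fields M" for X Y Z
  proof -
    have XY: "X + Y \<in> vector_fields M" using V sub subspace_add by blast
    have "mdiff M (X + Y) p v = mdiff M X p v + mdiff M Y p v" if "v \<in> tangent_space M p" for p v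
      using mdiff_add[OF V(1,2)[THEN vector_fieldsD(1)] that] by (simp add: plus_fun_def)
    moreover have "mdiff M Z p (X p + Y p) = mdiff M Z p (X p) + mdiff M Z p (Y p)" if "p \<in> M" for p
      using V that by (intro mdiff_linear T vector_fieldsD)
    ultimately have *: "lie_bracket M (X + Y) Z p = lie_bracket M X Z p + lie_bracket M Y Z p \<and>
        lie_bracket M Z (X + Y) p = lie_bracket M Z X p + lie_bracket M Z Y p" for p
      using V XY vector_fieldsD(2)[OF V(3)]
      by (cases "p \<in> M") (simp_all add: lie_bracket_eq[OF M] lie_bracket_outside)
    show "lie_bracket M (X + Y) Z = lie_bracket M X Z + lie_bracket M Y Z"
      "lie_bracket M Z (X + Y) = lie_bracket M Z X + lie_bracket M Z Y"
      using * by (simp_all add: fun_eq_iff)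
  qed
  have scale: "lie_bracket M (c *\<^sub>R X) Z = c *\<^sub>R lie_bracket M X Z"
    and scale': "lie_bracket M Z (c *\<^sub>R X) = c *\<^sub>R lie_bracket M Z X"
    if V: "X \<in> vector_fields M" "Z \<in> vector_fields M" for X Z c
  proof -
    have cX: "c *\<^sub>R X \<in> vector_fields M" using V sub subspace_scale by blast
    have "mdiff M (c *\<^sub>R X) p v = c *\<^sub>R mdiff M X p v" if "v \<in> tangent_space M p" for p v
      using mdiff_scaleR_const[OF V(1)[THEN vector_fieldsD(1)] that] by (simp add: scaleR_fun_def)
    moreover have "mdiff M Z p (c *\<^sub>R X p) = c *\<^sub>R mdiff M Z p (X p)" if "p \<in> M" for p
      using V that by (intro mdiff_linear T vector_fieldsD)
    ultimately have *: "lie_bracket M (c *\<^sub>R X) Z p = c *\<^sub>R lie_bracket M X Z p \<and>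
        lie_bracket M Z (c *\<^sub>R X) p = c *\<^sub>R lie_bracket M Z X p" for p
      using V cX vector_fieldsD(2)[OF V(2)]
      by (cases "p \<in> M")
        (simp_all add: lie_bracket_eq[OF M] lie_bracket_outside scaleR_diff_right, simp_all add: scaleR_fun_def)
    show "lie_bracket M (c *\<^sub>R X) Z = c *\<^sub>R lie_bracket M X Z"
      "lie_bracket M Z (c *\<^sub>R X) = c *\<^sub>R lie_bracket M Z X"
      using * by (simp_all add: fun_eq_iff scaleR_fun_def)
  qed
  have self: "lie_bracket M X X = 0" if "X \<in> vector_fields M" for X
  proof
    fix p show "lie_bracket M X X p = 0 p"
      using that by (cases "p \<in> M") (simp_all add: lie_bracket_eq[OF M] lie_bracket_outside)
  qed
  \<comment> \<open>The bracket acts on vector-valued functions as the commutator of derivations; applied to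
      the third field, this turns each double bracket into four second-order terms.\<close>
  have double: "lie_bracket M X (lie_bracket M Y Z) p =
      mdiff M (\<lambda>q. mdiff M Z q (Y q)) p (X p) - mdiff M (\<lambda>q. mdiff M Y q (Z q)) p (X p) -
      mdiff M (\<lambda>q. mdiff M X q (Z q)) p (Y p) + mdiff M (\<lambda>q. mdiff M X q (Y q)) p (Z p)"
    if V: "X \<in> vector_fields M" "Y \<in> vector_fields M" "Z \<in> vector_fields M" and p: "p \<in> M" for X Y Z p
  proof -
    have "mdiff M (lie_bracket M Y Z) p (X p) = mdiff M (\<lambda>q. mdiff M Z q (Y q) - mdiff M Y q (Z q)) p (X p)"
      using lie_bracket_eq[OF M V(2,3)] by (intro mdiff_cong)
    also have "\<dots> = mdiff M (\<lambda>q. mdiff M Z q (Y q)) p (X p) - mdiff M (\<lambda>q. mdiff M Y q (Z q)) p (X p)"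
      using V p by (intro mdiff_diff smooth_fun_mdiff vector_fieldsD)
    finally have 1: "mdiff M (lie_bracket M Y Z) p (X p) = \<dots>" .
    have 2: "mdiff M X p (lie_bracket M Y Z p) =
      mdiff M (\<lambda>q. mdiff M X q (Z q)) p (Y p) - mdiff M (\<lambda>q. mdiff M X q (Y q)) p (Z p)"
      using commutator_mdiff[OF M V(2,3) p vector_fieldsD(1)[OF V(1)]] lie_bracket_eq[OF M V(2,3) p]
      by simp
    show ?thesis
      using lie_bracket_eq[OF M V(1) lie_bracket_vector_fields[OF M V(2,3)] p] 1 2 by simp
  qed
  have jacobi: "lie_bracket M X (lie_bracket M Y Z) + lie_bracket M Y (lie_bracket M Z X) +
      lie_bracket M Z (lie_bracket M X Y) = 0"
    if V: "X \<in> vector_fields M" "Y \<in> vector_fields M" "Z \<in> vector_fields M" for X Y Z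
  proof
    fix p
    show "(lie_bracket M X (lie_bracket M Y Z) + lie_bracket M Y (lie_bracket M Z X) +
      lie_bracket M Z (lie_bracket M X Y)) p = 0 p"
      by (cases "p \<in> M") (simp_all add: double V lie_bracket_outside)
  qed
  show ?thesis
    unfolding lie_algebra_def
    using sub lie_bracket_vector_fields[OF M] add add' scale scale' self jacobi by simp
qed


section \<open>The exterior derivative of the restriction of an ambient 1-form\<close>

text \<open>For \<open>\<beta> = B \<bullet> dx\<close> restricted to M, the product rule gives
  \<open>X(\<beta>(Y)) = DB(X) \<bullet> Y + B \<bullet> DY(X)\<close>. The terms with derivatives of X and Y add up to
  \<open>\<beta>([X, Y])\<close>, so the invariant formula does not depend on the extensions. Retractions provide
  extensions, so that it applies to at least one pair of fields.\<close>

lemma ext_deriv_restriction: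
  assumes M: "submanifold M" and p: "p \<in> M"
    and uv: "u \<in> tangent_space M p" "v \<in> tangent_space M p"
    and B: "smooth_fun M B" and \<beta>: "\<And>q w. w \<in> tangent_space M q \<Longrightarrow> \<beta> q w = B q \<bullet> w"
  shows "ext_deriv M \<beta> p u v = mdiff M B p u \<bullet> v - mdiff M B p v \<bullet> u"
  unfolding ext_deriv_def
proof (rule the_equality)
  show "\<forall>U X Y. open U \<and> p \<in> U \<and>
        X \<in> vector_fields (M \<inter> U) \<and> Y \<in> vector_fields (M \<inter> U) \<and> X p = u \<and> Y p = v \<longrightarrow>
        mdiff M B p u \<bullet> v - mdiff M B p v \<bullet> u = mdiff (M \<inter> U) (\<lambda>q. \<beta> q (Y q)) p u -
            mdiff (M \<inter> U) (\<lambda>q. \<beta> q (X q)) p v - \<beta> p (lie_bracket (M \<inter> U) X Y p)"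
  proof (intro allI impI, elim conjE)
    fix U X Y
    assume U: "open U" "p \<in> U" and X: "X \<in> vector_fields (M \<inter> U)"
      and Y: "Y \<in> vector_fields (M \<inter> U)" and XY: "X p = u" "Y p = v"
    have MU: "submanifold (M \<inter> U)" "p \<in> M \<inter> U"
      using submanifold_Int_open[OF M U(1)] U p by auto
    have B': "smooth_fun (M \<inter> U) B"
      using B unfolding smooth_fun_def by (metis Int_iff)
    have *: "mdiff (M \<inter> U) (\<lambda>q. \<beta> q (Z q)) p w =
        B p \<bullet> mdiff (M \<inter> U) Z p w + mdiff M B p w \<bullet> Z p"
      if Z: "Z \<in> vector_fields (M \<inter> U)" and w: "w \<in> tangent_space M p" for Z w
    proof -
      have w': "w \<in> tangent_space (M \<inter> U) p"
        using w U by (simp add: tangent_space_Int_open)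
      have "mdiff (M \<inter> U) (\<lambda>q. \<beta> q (Z q)) p w = mdiff (M \<inter> U) (\<lambda>q. B q \<bullet> Z q) p w"
        by (intro mdiff_cong \<beta>) (use Z U vector_fieldsD(2)[OF Z] in \<open>auto simp: tangent_space_Int_open\<close>)
      also have "\<dots> = B p \<bullet> mdiff (M \<inter> U) Z p w + mdiff (M \<inter> U) B p w \<bullet> Z p"
        by (rule mdiff_inner[OF B' vector_fieldsD(1)[OF Z] w'])
      finally show ?thesis using U by (simp add: mdiff_Int_open)
    qed
    have "lie_bracket (M \<inter> U) X Y p \<in> tangent_space M p"
      using vector_fieldsD(2)[OF lie_bracket_vector_fields[OF MU(1) X Y] MU(2)] U
      by (simp add: tangent_space_Int_open)
    then have "\<beta> p (lie_bracket (M \<inter> U) X Y p) =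
        B p \<bullet> (mdiff (M \<inter> U) Y p (X p) - mdiff (M \<inter> U) X p (Y p))"
      using \<beta> lie_bracket_eq[OF MU(1) X Y MU(2)] by simp
    then show "mdiff M B p u \<bullet> v - mdiff M B p v \<bullet> u = mdiff (M \<inter> U) (\<lambda>q. \<beta> q (Y q)) p u -
        mdiff (M \<inter> U) (\<lambda>q. \<beta> q (X q)) p v - \<beta> p (lie_bracket (M \<inter> U) X Y p)"
      using *[OF Y uv(1)] *[OF X uv(2)] XY by (simp add: inner_diff_right)
  qed
  note formula = this
  fix d
  assume d: "\<forall>U X Y. open U \<and> p \<in> U \<and>
        X \<in> vector_fields (M \<inter> U) \<and> Y \<in> vector_fields (M \<inter> U) \<and> X p = u \<and> Y p = v \<longrightarrow>
        d = mdiff (M \<inter> U) (\<lambda>q. \<beta> q (Y q)) p u -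
            mdiff (M \<inter> U) (\<lambda>q. \<beta> q (X q)) p v - \<beta> p (lie_bracket (M \<inter> U) X Y p)"
  obtain U r where U: "p \<in> U" "smooth_retraction M U r"
    by (rule submanifoldE[OF M p])
  obtain X where X: "X \<in> vector_fields (M \<inter> U)" "X p = u"
    by (rule tangent_vector_extension[OF U(2) p U(1) uv(1)])
  obtain Y where Y: "Y \<in> vector_fields (M \<inter> U)" "Y p = v"
    by (rule tangent_vector_extension[OF U(2) p U(1) uv(2)])
  have "open U \<and> p \<in> U \<and> X \<in> vector_fields (M \<inter> U) \<and> Y \<in> vector_fields (M \<inter> U) \<and> X p = u \<and> Y p = v"
    using U smooth_retractionD(1) X Y by blast
  then show "d = mdiff M B p u \<bullet> v - mdiff M B p v \<bullet> u"
    using d[rule_format, of U X Y] formula[rule_format, of U X Y] by simp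
qed


section \<open>Hypersurfaces\<close>

lemma dderiv_inverse:
  assumes "smooth_on \<Phi> U" "smooth_on \<Psi> V" "open U" "x \<in> U" "\<Phi> ` U \<subseteq> V"
    and "\<And>x. x \<in> U \<Longrightarrow> \<Psi> (\<Phi> x) = x"
  shows "dderiv \<Psi> (\<Phi> x) (dderiv \<Phi> x v) = v"
proof -
  have "((\<lambda>x. \<Psi> (\<Phi> x)) has_derivative (\<lambda>v. dderiv \<Psi> (\<Phi> x) (dderiv \<Phi> x v))) (at x)"
    using has_derivative_compose[OF smooth_on_has_derivative[OF assms(1,4)], of \<Psi> "dderiv \<Psi> (\<Phi> x)"]
      smooth_on_has_derivative[OF assms(2), of "\<Phi> x"] assms(4,5) by auto
  then have "((\<lambda>x. x) has_derivative (\<lambda>v. dderiv \<Psi> (\<Phi> x) (dderiv \<Phi> x v))) (at x)"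
    by (rule has_derivative_transform_within_open[OF _ assms(3,4)]) (rule assms(6))
  then have "(\<lambda>v. dderiv \<Psi> (\<Phi> x) (dderiv \<Phi> x v)) = (\<lambda>v. v)"
    using has_derivative_ident has_derivative_unique by blast
  then show ?thesis by metis
qed

text \<open>Straightening the hypersurface to the hyperplane orthogonal to e, the retraction is the
  orthogonal projection to that hyperplane, and the function \<open>e \<bullet> \<Phi>\<close> is a local equation of
  the hypersurface, whose gradient is a normal field.\<close>

lemma hypersurface_local_structure:
  assumes "smooth_hypersurface \<gamma>" "p \<in> \<gamma>"
  obtains U r N where "p \<in> U" "smooth_retraction \<gamma> U r" "smooth_on N U"
    "\<And>x. x \<in> U \<Longrightarrow> N x \<noteq> 0"
    "\<And>x. x \<in> \<gamma> \<inter> U \<Longrightarrow> tangent_space \<gamma> x = {v. N x \<bullet> v = 0}"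
proof -
  obtain U V \<Phi> \<Psi> and e :: 'a where op: "open U" "open V" and pU: "p \<in> U"
    and h: "homeomorphism U V \<Phi> \<Psi>" and sm: "smooth_on \<Phi> U" "smooth_on \<Psi> V"
    and e: "e \<noteq> 0" "\<Phi> ` (\<gamma> \<inter> U) = {y\<in>V. e \<bullet> y = 0}"
    using assms(1)[unfolded smooth_hypersurface_def, THEN bspec, OF assms(2)]
    by - (elim exE conjE, rule that)
  have inv: "\<And>x. x \<in> U \<Longrightarrow> \<Psi> (\<Phi> x) = x" "\<And>y. y \<in> V \<Longrightarrow> \<Phi> (\<Psi> y) = y" "\<Phi> ` U = V" "\<Psi> ` V = U"
    using homeomorphism_apply1[OF h] homeomorphism_apply2[OF h] homeomorphism_image1[OF h]
      homeomorphism_image2[OF h] by blast+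
  define \<pi> where "\<pi> y = y - ((e \<bullet> y) / (e \<bullet> e)) *\<^sub>R e" for y
  have e\<pi>: "e \<bullet> \<pi> y = 0" for y
    using e(1) by (simp add: \<pi>_def inner_diff_right)
  have \<pi>_fix: "\<pi> y = y" if "e \<bullet> y = 0" for y
    using that by (simp add: \<pi>_def)
  have \<pi>_lin: "bounded_linear \<pi>"
    unfolding \<pi>_def
    by (intro bounded_linear_intros) (simp add: divide_inverse bounded_linear_mult_const bounded_linear_inner_right)
  have on: "x \<in> \<gamma> \<longleftrightarrow> e \<bullet> \<Phi> x = 0" if "x \<in> U" for x
  proof
    assume "x \<in> \<gamma>"
    then have "\<Phi> x \<in> \<Phi> ` (\<gamma> \<inter> U)" using that by blast
    then show "e \<bullet> \<Phi> x = 0" unfolding e(2) by blast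
  next
    assume "e \<bullet> \<Phi> x = 0"
    then have "\<Phi> x \<in> \<Phi> ` (\<gamma> \<inter> U)" unfolding e(2) using inv(3) that by blast
    then show "x \<in> \<gamma>" using inv(1) that by (metis IntE imageE)
  qed
  define U' where "U' = U \<inter> (\<lambda>x. \<pi> (\<Phi> x)) -` V"
  define r where "r x = \<Psi> (\<pi> (\<Phi> x))" for x
  have "continuous_on U (\<lambda>x. \<pi> (\<Phi> x))"
    by (intro bounded_linear.continuous_on[OF \<pi>_lin] smooth_on_continuous sm)
  then have op': "open U'"
    unfolding U'_def using op by (rule continuous_open_preimage)
  have sm_\<pi>\<Phi>: "smooth_on (\<lambda>x. \<pi> (\<Phi> x)) U'"
    by (rule smooth_on_subset[OF smooth_on_compose_linear[OF \<pi>_lin sm(1) op(1)]]) (auto simp: U'_def)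
  have sm_r: "smooth_on r U'"
    unfolding r_def by (rule smooth_on_compose[OF sm(2) sm_\<pi>\<Phi> _ op' op(2)]) (auto simp: U'_def)
  have r_U: "r x \<in> U" "\<Phi> (r x) = \<pi> (\<Phi> x)" if "x \<in> U'" for x
    using that inv by (auto simp: U'_def r_def)
  have r: "smooth_retraction \<gamma> U' r"
    unfolding smooth_retraction_def
  proof (intro conjI op' sm_r ballI)
    show "r ` U' \<subseteq> \<gamma> \<inter> U'"
      using r_U on e\<pi> \<pi>_fix by (auto simp: U'_def)
    show "r x = x" if "x \<in> \<gamma> \<inter> U'" for x
      using that on[of x] \<pi>_fix inv(1)[of x] by (simp add: U'_def r_def)
  qed
  have D: "((\<lambda>x. e \<bullet> \<Phi> x) has_derivative (\<lambda>v. e \<bullet> dderiv \<Phi> x v)) (at x)" if "x \<in> U" for x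
    by (intro has_derivative_inner_right smooth_on_has_derivative[OF sm(1) that])
  define N where "N = grad (\<lambda>x. e \<bullet> \<Phi> x)"
  have N: "N x \<bullet> v = e \<bullet> dderiv \<Phi> x v" if "x \<in> U" for x v
    using grad_inner[of "\<lambda>x. e \<bullet> \<Phi> x" x v] dderiv_eqI[OF D[OF that]] D[OF that]
    by (auto simp: N_def differentiable_def)
  have sm_N: "smooth_on N U"
    unfolding N_def by (intro smooth_on_grad smooth_on_inner smooth_on_const sm op)
  have N0: "N x \<noteq> 0" if "x \<in> U" for x
  proof -
    have "dderiv \<Phi> (\<Psi> (\<Phi> x)) (dderiv \<Psi> (\<Phi> x) e) = e"
      by (rule dderiv_inverse[OF sm(2,1) op(2)]) (use inv that in auto)
    then have "N x \<bullet> dderiv \<Psi> (\<Phi> x) e = e \<bullet> e"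
      using N[OF that] inv(1)[OF that] by simp
    then show ?thesis using e(1) by auto
  qed
  have T: "tangent_space \<gamma> x = {v. N x \<bullet> v = 0}" if x: "x \<in> \<gamma> \<inter> U'" for x
  proof -
    have xU: "x \<in> U" "x \<in> U'" using x by (auto simp: U'_def)
    have "N x \<bullet> v = 0" if v: "v \<in> tangent_space \<gamma> x" for v
    proof -
      have "mdiff \<gamma> (\<lambda>x. 0) x v = e \<bullet> dderiv \<Phi> x v"
        by (rule mdiff_eqI[OF v op(1) xU(1) D[OF xU(1)]]) (use on in auto)
      then show ?thesis using mdiff_const[OF v] N[OF xU(1)] by metis
    qed
    moreover have "v \<in> tangent_space \<gamma> x" if v: "N x \<bullet> v = 0" for v
    proof -
      have \<pi>x: "\<pi> (\<Phi> x) = \<Phi> x"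
        using x xU on \<pi>_fix by auto
      have "((\<lambda>x. \<pi> (\<Phi> x)) has_derivative (\<lambda>v. \<pi> (dderiv \<Phi> x v))) (at x)"
        by (intro bounded_linear.has_derivative[OF \<pi>_lin] smooth_on_has_derivative[OF sm(1) xU(1)])
      then have "(r has_derivative (\<lambda>v. dderiv \<Psi> (\<Phi> x) (\<pi> (dderiv \<Phi> x v)))) (at x)"
        unfolding r_def[abs_def] using inv(3) xU(1) \<pi>x
        by (intro has_derivative_compose[of "\<lambda>x. \<pi> (\<Phi> x)" _ x UNIV \<Psi>])
          (auto intro!: smooth_on_has_derivative[OF sm(2)])
      then have "dderiv r x v = dderiv \<Psi> (\<Phi> x) (\<pi> (dderiv \<Phi> x v))"
        by (simp add: dderiv_eqI)
      also have "\<dots> = v"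
        using v N[OF xU(1)] \<pi>_fix dderiv_inverse[OF sm op(1) xU(1), of v] inv by simp
      finally show ?thesis
        using tangent_space_retraction[OF r _ xU(2)] x by auto
    qed
    ultimately show ?thesis by blast
  qed
  have "p \<in> U'"
    using pU assms(2) on[OF pU] \<pi>_fix inv(3) by (auto simp: U'_def)
  then show thesis
    by (rule that[OF _ r smooth_on_subset[OF sm_N]]) (use N0 T in \<open>auto simp: U'_def\<close>)
qed

lemma hypersurface_submanifold: "smooth_hypersurface \<gamma> \<Longrightarrow> submanifold \<gamma>"
  unfolding submanifold_def using hypersurface_local_structure by metis


section \<open>The tangent bundle and its symplectic form\<close>

text \<open>The tangent map of a retraction is a retraction again: it lands in the tangent bundle
  because \<open>Dr(x) w\<close> is tangent at \<open>r x\<close>, and it fixes the tangent bundle because \<open>Dr(x)\<close> fixes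
  the tangent vectors at x.\<close>

lemma tangent_bundle_retraction:
  assumes "smooth_retraction M U r"
  shows "smooth_retraction (tangent_bundle M) (U \<times> UNIV) (\<lambda>z. (r (fst z), dderiv r (fst z) (snd z)))"
    (is "smooth_retraction _ ?U ?R")
proof -
  note r = smooth_retractionD[OF assms]
  have op: "open ?U" using r(1) by (simp add: open_Times)
  have "smooth_on ?R ?U"
    by (intro smooth_on_Pair smooth_on_compose[OF r(2)] smooth_on_dderiv[OF r(2)] op r(1)
        smooth_on_linear[OF bounded_linear_fst] smooth_on_linear[OF bounded_linear_snd]) auto
  moreover have "?R z \<in> tangent_bundle M" if "z \<in> ?U" for z
    using that r(3) dderiv_retraction_tangent[OF assms] by (auto simp: tangent_bundle_def)
  moreover have "?R z = z" if "z \<in> tangent_bundle M \<inter> ?U" for z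
    using that r(5) tangent_space_retraction[OF assms] by (auto simp: tangent_bundle_def)
  ultimately show ?thesis
    using op r(4) by (auto simp: smooth_retraction_def)
qed

lemma submanifold_tangent_bundle:
  assumes "submanifold M"
  shows "submanifold (tangent_bundle M)"
  unfolding submanifold_def
proof
  fix z assume "z \<in> tangent_bundle M"
  then have "fst z \<in> M" by (auto simp: tangent_bundle_def)
  then obtain U r where U: "fst z \<in> U" "smooth_retraction M U r"
    using submanifoldE[OF assms] by metis
  have z: "z \<in> U \<times> UNIV" using U(1) by (cases z) simp
  show "\<exists>U r. z \<in> U \<and> smooth_retraction (tangent_bundle M) U r"
    by (intro exI conjI, rule z, rule tangent_bundle_retraction[OF U(2)])
qed

text \<open>The next three lemmas describe the tangent space of the tangent bundle at \<open>(x, w)\<close> as an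
  extension of the tangent space at x by itself: the first components are exactly the tangent
  vectors at x, and so are the second components of the vertical vectors.\<close>

lemma tangent_bundle_horizontal:
  assumes "v \<in> tangent_space (tangent_bundle M) z"
  shows "fst v \<in> tangent_space M (fst z)"
proof -
  have "dderiv fst z v \<in> tangent_space M (fst z)"
    by (rule tangent_space_image[OF assms smooth_on_linear[OF bounded_linear_fst open_UNIV]])
      (auto simp: tangent_bundle_def)
  moreover have "dderiv fst z = fst"
    by (intro dderiv_eqI bounded_linear_imp_has_derivative bounded_linear_fst)
  ultimately show ?thesis by simp
qed

lemma tangent_bundle_vertical:
  assumes M: "submanifold M" and xw: "(x, w) \<in> tangent_bundle M"
  shows "(0, b) \<in> tangent_space (tangent_bundle M) (x, w) \<longleftrightarrow> b \<in> tangent_space M x"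
proof
  have x: "x \<in> M" and w: "w \<in> tangent_space M x"
    using xw by (auto simp: tangent_bundle_def)
  note T = subspace_tangent_space[OF M x]
  show "(0, b) \<in> tangent_space (tangent_bundle M) (x, w)" if b: "b \<in> tangent_space M x"
  proof -
    have "dderiv (\<lambda>t::real. (x, w + t *\<^sub>R b)) 0 1 \<in>
        tangent_space (tangent_bundle M) ((\<lambda>t. (x, w + t *\<^sub>R b)) 0)"
    proof (rule tangent_space_image[of _ UNIV _ _ UNIV])
      show "smooth_on (\<lambda>t::real. (x, w + t *\<^sub>R b)) UNIV"
        by (intro smooth_on_Pair smooth_on_add smooth_on_scaleR smooth_on_const smooth_on_ident) auto
      show "(x, w + t *\<^sub>R b) \<in> tangent_bundle M" for t
        using x w b T by (auto simp: tangent_bundle_def subspace_add subspace_scale)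
    qed (auto simp: tangent_space_UNIV)
    moreover have "((\<lambda>t::real. (x, w + t *\<^sub>R b)) has_derivative (\<lambda>t. (0, t *\<^sub>R b))) (at 0)"
      by (auto intro!: derivative_eq_intros)
    then have "dderiv (\<lambda>t::real. (x, w + t *\<^sub>R b)) 0 1 = (0, b)"
      by (simp add: dderiv_eqI)
    ultimately show ?thesis by simp
  qed
  assume b: "(0, b) \<in> tangent_space (tangent_bundle M) (x, w)"
  obtain U r where U: "x \<in> U" "smooth_retraction M U r"
    by (rule submanifoldE[OF M x])
  define R where "R z = (r (fst z), dderiv r (fst z) (snd z))" for z
  have R: "smooth_retraction (tangent_bundle M) (U \<times> UNIV) R"
    using tangent_bundle_retraction[OF U(2)] by (simp add: R_def[abs_def])
  \<comment> \<open>On the fibre over x the retraction is the linear map \<open>Dr(x)\<close>.\<close>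
  have "((\<lambda>z. R (x, z)) has_derivative (\<lambda>c. dderiv R (x, w) (0, c))) (at w)"
    by (rule has_derivative_compose[of "Pair x", OF has_derivative_Pair[OF has_derivative_const has_derivative_ident]])
      (use smooth_on_has_derivative[OF smooth_retractionD(2)[OF R]] U in auto)
  moreover have "((\<lambda>z. R (x, z)) has_derivative (\<lambda>c. (0, dderiv r x c))) (at w)"
    using smooth_on_has_derivative[OF smooth_retractionD(2)[OF U(2)] U(1)]
    unfolding R_def fst_conv snd_conv
    by (intro has_derivative_Pair has_derivative_const bounded_linear_imp_has_derivative)
      (rule has_derivative_bounded_linear)
  ultimately have "dderiv R (x, w) (0, b) = (0, dderiv r x b)"
    using has_derivative_unique by metis
  moreover have "dderiv R (x, w) (0, b) = (0, b)"
    using b tangent_space_retraction[OF R xw] U(1) by auto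
  ultimately show "b \<in> tangent_space M x"
    using tangent_space_retraction[OF U(2) x U(1)] by auto
qed

lemma tangent_bundle_lift:
  assumes M: "submanifold M" and xw: "(x, w) \<in> tangent_bundle M" and a: "a \<in> tangent_space M x"
  obtains b where "(a, b) \<in> tangent_space (tangent_bundle M) (x, w)"
proof -
  have x: "x \<in> M" and w: "w \<in> tangent_space M x"
    using xw by (auto simp: tangent_bundle_def)
  obtain U r where U: "x \<in> U" "smooth_retraction M U r"
    by (rule submanifoldE[OF M x])
  note r = smooth_retractionD[OF U(2)]
  have dr: "dderiv r x v = v" if "v \<in> tangent_space M x" for v
    using that tangent_space_retraction[OF U(2) x U(1)] by auto
  \<comment> \<open>The derivative of r extends w to a section of the tangent bundle, which carries a upstairs.\<close>
  define G where "G y = (r y, dderiv r y w)" for y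
  have "smooth_on G U"
    unfolding G_def by (intro smooth_on_Pair smooth_on_dderiv_fixed r)
  then have "dderiv G x a \<in> tangent_space (tangent_bundle M) (G x)"
    by (rule tangent_space_image[OF a _ r(1) U(1)])
      (use r(3) dderiv_retraction_tangent[OF U(2)] in \<open>auto simp: G_def tangent_bundle_def\<close>)
  moreover have "(G has_derivative (\<lambda>a. (dderiv r x a, dderiv (\<lambda>y. dderiv r y w) x a))) (at x)"
    unfolding G_def[abs_def]
    by (intro has_derivative_Pair smooth_on_has_derivative[OF _ U(1)] smooth_on_dderiv_fixed r)
  then have "dderiv G x a = (a, dderiv (\<lambda>y. dderiv r y w) x a)"
    by (simp add: dderiv_eqI dr[OF a])
  moreover have "G x = (x, w)"
    using r(5)[OF x U(1)] dr[OF w] by (simp add: G_def)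
  ultimately show thesis
    using that by metis
qed

lemma mdiff_bounded_linear:
  "bounded_linear L \<Longrightarrow> v \<in> tangent_space M p \<Longrightarrow> mdiff M L p v = L v"
  by (rule mdiff_eqI[OF _ open_UNIV UNIV_I]) (auto intro: bounded_linear_imp_has_derivative)

text \<open>The Liouville form is the restriction of \<open>w \<bullet> dx\<close> from the ambient space, so the
  symplectic form is the restriction of \<open>\<Sum> dw\<^sub>i \<and> dx\<^sub>i\<close>.\<close>

lemma symplectic_eq:
  assumes M: "submanifold M" and z: "z \<in> tangent_bundle M"
    and u: "u \<in> tangent_space (tangent_bundle M) z" and v: "v \<in> tangent_space (tangent_bundle M) z"
  shows "symplectic M z u v = snd u \<bullet> fst v - snd v \<bullet> fst u"
proof -
  define B :: "'a \<times> 'a \<Rightarrow> 'a \<times> 'a" where "B q = (snd q, 0)" for q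
  have B: "bounded_linear B"
    unfolding B_def[abs_def] by (intro bounded_linear_Pair bounded_linear_snd bounded_linear_zero)
  have "liouville M q w = B q \<bullet> w" if "w \<in> tangent_space (tangent_bundle M) q" for q w
    using mdiff_bounded_linear[OF bounded_linear_fst that]
    by (simp add: liouville_def B_def inner_prod_def)
  then have "symplectic M z u v =
      mdiff (tangent_bundle M) B z u \<bullet> v - mdiff (tangent_bundle M) B z v \<bullet> u"
    unfolding symplectic_def
    by (intro ext_deriv_restriction submanifold_tangent_bundle M z u v smooth_fun_linear B)
  then show ?thesis
    using mdiff_bounded_linear[OF B u] mdiff_bounded_linear[OF B v]
    by (simp add: B_def inner_prod_def)
qed

lemma unit_bundle_eq: "unit_bundle M = tangent_bundle M \<inter> {z. norm (snd z) < 1}"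
  by (auto simp: unit_bundle_def)

lemma open_norm_snd_less: "open {z :: 'a::euclidean_space \<times> 'a. norm (snd z) < 1}"
  by (intro open_Collect_less continuous_on_norm continuous_on_snd continuous_on_id continuous_on_const)

lemma tangent_space_unit_bundle:
  "z \<in> unit_bundle M \<Longrightarrow> tangent_space (unit_bundle M) z = tangent_space (tangent_bundle M) z"
  unfolding unit_bundle_eq by (rule tangent_space_Int_open[OF open_norm_snd_less]) auto


section \<open>Hamiltonian fields and Poisson brackets\<close>

text \<open>If the differential of F is \<open>A \<bullet> dw + B \<bullet> dx\<close> with A tangent to the hypersurface, the
  Hamiltonian field has horizontal part A, and its vertical part is determined up to its normal
  component by \<open>- B\<close>. The normal component is whatever tangency to the tangent bundle
  dictates: a lift \<open>(A, b)\<close> of A exists, and adding vertical vectors \<open>(0, c)\<close> to it adjusts the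
  tangential component of b at will.\<close>

lemma ham_field_eq:
  assumes M: "submanifold M" and xw: "(x, w) \<in> unit_bundle M" and A: "A \<in> tangent_space M x"
    and dF: "\<And>a b. (a, b) \<in> tangent_space (tangent_bundle M) (x, w) \<Longrightarrow>
      mdiff (unit_bundle M) F (x, w) (a, b) = A \<bullet> b + B \<bullet> a"
  shows "ham_field M F (x, w) \<in> tangent_space (tangent_bundle M) (x, w)"
    and "fst (ham_field M F (x, w)) = A"
    and "\<And>a. a \<in> tangent_space M x \<Longrightarrow> snd (ham_field M F (x, w)) \<bullet> a = - (B \<bullet> a)"
proof -
  let ?T = "tangent_space (tangent_bundle M) (x, w)"
  have TM: "(x, w) \<in> tangent_bundle M" and x: "x \<in> M"
    using xw by (auto simp: unit_bundle_def tangent_bundle_def)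
  note T = subspace_tangent_space[OF submanifold_tangent_bundle[OF M] TM]
  obtain b where b: "(A, b) \<in> ?T"
    by (rule tangent_bundle_lift[OF M TM A])
  have span: "span (tangent_space M x) = tangent_space M x"
    using subspace_tangent_space[OF M x] by (simp only: span_eq_iff)
  obtain c d where c: "c \<in> tangent_space M x" and d: "\<And>a. a \<in> tangent_space M x \<Longrightarrow> orthogonal d a"
    and cd: "- (B + b) = c + d"
    by (rule orthogonal_subspace_decomp_exists[of "tangent_space M x" "- (B + b)", unfolded span])
      (rule that)
  define v where "v = (A, b + c)"
  have "(A, b) + (0, c) \<in> ?T"
    using b c tangent_bundle_vertical[OF M TM] by (intro subspace_add[OF T]) auto
  then have v: "v \<in> ?T"
    by (simp add: v_def)
  have vB: "snd v \<bullet> a = - (B \<bullet> a)" if "a \<in> tangent_space M x" for a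
  proof -
    have "b + c = b - (B + b) - d" using cd by (simp add: algebra_simps)
    then have "snd v = - B - d" by (simp add: v_def)
    then show ?thesis using d[OF that] by (simp add: orthogonal_def inner_diff_left)
  qed
  have ham: "ham_field M F (x, w) = v"
    unfolding ham_field_def tangent_space_unit_bundle[OF xw]
  proof (rule the_equality)
    show "v \<in> ?T \<and> (\<forall>u\<in>?T. symplectic M (x, w) v u = - mdiff (unit_bundle M) F (x, w) u)"
    proof (intro conjI ballI v)
      fix u assume u: "u \<in> ?T"
      have "symplectic M (x, w) v u = snd v \<bullet> fst u - snd u \<bullet> A"
        using symplectic_eq[OF M TM v u] by (simp add: v_def)
      also have "\<dots> = - (B \<bullet> fst u) - snd u \<bullet> A"
        using vB tangent_bundle_horizontal[OF u] by simp
      also have "\<dots> = - mdiff (unit_bundle M) F (x, w) u"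
        using dF[of "fst u" "snd u"] u by (simp add: inner_commute)
      finally show "symplectic M (x, w) v u = - mdiff (unit_bundle M) F (x, w) u" .
    qed
    note v_ham = this
    fix v'
    assume v': "v' \<in> ?T \<and> (\<forall>u\<in>?T. symplectic M (x, w) v' u = - mdiff (unit_bundle M) F (x, w) u)"
    \<comment> \<open>Nondegeneracy: pairing with vertical vectors gives \<open>fst v' = fst v\<close>, so the difference is
        vertical, and pairing it with lifts of tangent vectors gives \<open>snd v' = snd v\<close>.\<close>
    define e where "e = v' - v"
    have e: "e \<in> ?T"
      using v v' unfolding e_def by (intro subspace_diff[OF T]) auto
    have eq: "snd e \<bullet> fst u = snd u \<bullet> fst e" if u: "u \<in> ?T" for u
    proof -
      have "symplectic M (x, w) v' u = symplectic M (x, w) v u"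
        using bspec[OF conjunct2[OF v'] u] bspec[OF conjunct2[OF v_ham] u] by simp
      then show ?thesis
        using symplectic_eq[OF M TM v u] symplectic_eq[OF M TM _ u, of v'] v'
        by (simp add: e_def inner_diff_left inner_diff_right)
    qed
    have "(0, fst e) \<in> ?T"
      using tangent_bundle_vertical[OF M TM] tangent_bundle_horizontal[OF e] by simp
    from eq[OF this] have e1: "fst e = 0" by simp
    then have "snd e \<in> tangent_space M x"
      using e tangent_bundle_vertical[OF M TM, of "snd e"] by (cases e) simp
    then obtain b' where "(snd e, b') \<in> ?T"
      by (rule tangent_bundle_lift[OF M TM])
    from eq[OF this] e1 have "snd e = 0" by simp
    with e1 have "e = 0" by (simp add: prod_eq_iff)
    then show "v' = v" by (simp add: e_def)
  qed
  show "ham_field M F (x, w) \<in> ?T" "fst (ham_field M F (x, w)) = A"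
    using v by (simp_all add: ham) (simp add: v_def)
  show "snd (ham_field M F (x, w)) \<bullet> a = - (B \<bullet> a)" if "a \<in> tangent_space M x" for a
    using vB[OF that] by (simp add: ham)
qed

text \<open>As the covectors A are tangent, the undetermined normal components of the Hamiltonian fields
  drop out of \<open>\<omega>(X\<^sub>F, X\<^sub>G)\<close>, which becomes the canonical formula in ambient coordinates.\<close>

lemma poisson_eq:
  assumes M: "submanifold M" and xw: "(x, w) \<in> unit_bundle M"
    and A: "A \<in> tangent_space M x" "A' \<in> tangent_space M x"
    and dF: "\<And>a b. (a, b) \<in> tangent_space (tangent_bundle M) (x, w) \<Longrightarrow>
      mdiff (unit_bundle M) F (x, w) (a, b) = A \<bullet> b + B \<bullet> a"
    and dG: "\<And>a b. (a, b) \<in> tangent_space (tangent_bundle M) (x, w) \<Longrightarrow>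
      mdiff (unit_bundle M) G (x, w) (a, b) = A' \<bullet> b + B' \<bullet> a"
  shows "poisson M F G (x, w) = B' \<bullet> A - B \<bullet> A'"
proof -
  note F = ham_field_eq[OF M xw A(1) dF] and G = ham_field_eq[OF M xw A(2) dG]
  have "(x, w) \<in> tangent_bundle M"
    using xw by (simp add: unit_bundle_def)
  then show ?thesis
    using xw symplectic_eq[OF M _ F(1) G(1)] F(3)[OF _ A(2)] G(3)[OF _ A(1)]
    by (simp add: poisson_def F(2) G(2))
qed

lemma poisson_outside: "z \<notin> unit_bundle M \<Longrightarrow> poisson M F G z = 0"
  by (simp add: poisson_def)

lemma gradient_exists:
  fixes f :: "'a::euclidean_space \<Rightarrow> real"
  assumes "smooth_fun M f" "p \<in> M"
  obtains g where "\<And>v. v \<in> tangent_space M p \<Longrightarrow> g \<bullet> v = mdiff M f p v"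
proof -
  obtain U F where U: "open U" "p \<in> U" "smooth_on F U" "\<And>x. x \<in> M \<inter> U \<Longrightarrow> F x = f x"
    using smooth_fun_local_extension[OF assms] by metis
  have "grad F p \<bullet> v = mdiff M f p v" if "v \<in> tangent_space M p" for v
    using mdiff_extension[OF U(1,3,4,2) that] grad_inner[OF smooth_on_differentiable[OF U(3,2)]]
    by simp
  then show thesis by (rule that)
qed

lemma mdiff_H:
  assumes f: "smooth_fun M f" and xw: "(x, w) \<in> unit_bundle M"
    and g: "\<And>v. v \<in> tangent_space M x \<Longrightarrow> g \<bullet> v = mdiff M f x v"
    and ab: "(a, b) \<in> tangent_space (tangent_bundle M) (x, w)"
  defines "s \<equiv> sqrt (1 - (norm w)\<^sup>2)"
  shows "mdiff (unit_bundle M) (H M f) (x, w) (a, b) =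
    ((2 * f x / s) *\<^sub>R w) \<bullet> b + ((- 2 * s) *\<^sub>R g) \<bullet> a"
proof -
  have x: "x \<in> M" and w: "norm w < 1"
    using xw by (auto simp: unit_bundle_def tangent_bundle_def)
  then have s: "0 < 1 - (norm w)\<^sup>2"
    by (simp add: power_less_one_iff abs_square_less_1)
  obtain U F where U: "open U" "x \<in> U" "smooth_on F U" "\<And>x. x \<in> M \<inter> U \<Longrightarrow> F x = f x"
    using smooth_fun_local_extension[OF f x] by metis
  have mdF: "mdiff (unit_bundle M) (H M f) (x, w) (a, b) =
      (\<lambda>z. - 2 * ((- 2 * (w \<bullet> snd z) * (inverse s / 2)) * F x + s * dderiv F x (fst z))) (a, b)"
  proof (rule mdiff_eqI[where U = "U \<times> UNIV"])
    show "(a, b) \<in> tangent_space (unit_bundle M) (x, w)"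
      using ab tangent_space_unit_bundle[OF xw] by simp
    show "open (U \<times> (UNIV :: 'a set))" "(x, w) \<in> U \<times> UNIV"
      using U by (auto simp: open_Times)
    have 1: "((\<lambda>z. sqrt (1 - snd z \<bullet> snd z)) has_derivative
        (\<lambda>z. (- 2 * (w \<bullet> snd z)) * (inverse s / 2))) (at (x, w))"
    proof -
      have "((\<lambda>z. 1 - snd z \<bullet> snd z) has_derivative (\<lambda>z. - 2 * (w \<bullet> snd z))) (at (x, w))"
        by (auto intro!: derivative_eq_intros simp: inner_commute)
      moreover have "DERIV sqrt (1 - snd (x, w) \<bullet> snd (x, w)) :> inverse s / 2"
        using DERIV_real_sqrt[OF s] by (simp add: s_def power2_norm_eq_inner)
      ultimately show ?thesis
        by (rule DERIV_compose_FDERIV[where f = sqrt and g = "\<lambda>z. 1 - snd z \<bullet> snd z", rotated])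
    qed
    have 2: "((\<lambda>z. F (fst z)) has_derivative (\<lambda>z. dderiv F x (fst z))) (at (x, w))"
      by (rule has_derivative_compose[OF bounded_linear_imp_has_derivative[OF bounded_linear_fst]])
        (use smooth_on_has_derivative[OF U(3,2)] in simp)
    have "((\<lambda>z. - 2 * (sqrt (1 - snd z \<bullet> snd z) * F (fst z))) has_derivative
      (\<lambda>z. - 2 * (sqrt (1 - snd (x, w) \<bullet> snd (x, w)) * dderiv F x (fst z) +
        (- 2 * (w \<bullet> snd z)) * (inverse s / 2) * F (fst (x, w))))) (at (x, w))"
      by (intro has_derivative_mult_right has_derivative_mult 1 2)
    then show "((\<lambda>z. - 2 * (sqrt (1 - snd z \<bullet> snd z) * F (fst z))) has_derivative
      (\<lambda>z. - 2 * ((- 2 * (w \<bullet> snd z) * (inverse s / 2)) * F x + s * dderiv F x (fst z)))) (at (x, w))"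
      by (simp add: s_def power2_norm_eq_inner add.commute)
    show "- 2 * (sqrt (1 - snd z \<bullet> snd z) * F (fst z)) = H M f z"
      if "z \<in> unit_bundle M \<inter> U \<times> UNIV" for z
      using that U(4)[of "fst z"]
      by (auto simp: H_def power2_norm_eq_inner unit_bundle_def tangent_bundle_def)
  qed
  have a: "a \<in> tangent_space M x"
    using tangent_bundle_horizontal[OF ab] by simp
  have dF: "dderiv F x a = g \<bullet> a"
    using mdiff_extension[OF U(1,3,4,2) a] g[OF a] by simp
  have Fx: "F x = f x"
    by (rule U(4)) (use U(2) x in simp)
  show ?thesis
    by (simp add: mdF dF Fx inverse_eq_divide algebra_simps)
qed

text \<open>The factor \<open>1 / s\<close> of the fibre derivative of one function cancels the factor s of the base
  derivative of the other; hence the bracket is linear in w although \<open>H\<^sub>f\<close> and \<open>H\<^sub>g\<close> are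
  not.\<close>

lemma poisson_H:
  assumes M: "submanifold M" and f: "smooth_fun M f" and g: "smooth_fun M g"
    and xw: "(x, w) \<in> unit_bundle M"
  shows "poisson M (H M f) (H M g) (x, w) = 4 * (g x * mdiff M f x w - f x * mdiff M g x w)"
proof -
  define s where "s = sqrt (1 - (norm w)\<^sup>2)"
  have x: "x \<in> M" and w: "w \<in> tangent_space M x" and "norm w < 1"
    using xw by (auto simp: unit_bundle_def tangent_bundle_def)
  then have "(norm w)\<^sup>2 < 1"
    by (simp add: power_less_one_iff abs_square_less_1)
  then have s: "s \<noteq> 0"
    by (simp add: s_def)
  obtain F where F: "\<And>v. v \<in> tangent_space M x \<Longrightarrow> F \<bullet> v = mdiff M f x v"
    using gradient_exists[OF f x] by metis
  obtain G where G: "\<And>v. v \<in> tangent_space M x \<Longrightarrow> G \<bullet> v = mdiff M g x v"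
    using gradient_exists[OF g x] by metis
  have "c *\<^sub>R w \<in> tangent_space M x" for c
    using subspace_scale[OF subspace_tangent_space[OF M x] w] .
  then have "poisson M (H M f) (H M g) (x, w) =
      ((- 2 * s) *\<^sub>R G) \<bullet> ((2 * f x / s) *\<^sub>R w) - ((- 2 * s) *\<^sub>R F) \<bullet> ((2 * g x / s) *\<^sub>R w)"
    unfolding s_def
    by (intro poisson_eq[OF M xw _ _ mdiff_H[OF f xw F] mdiff_H[OF g xw G]])
  then show ?thesis
    using s F[OF w] G[OF w] by (simp add: algebra_simps)
qed

text \<open>The function on the unit bundle that is given by the 1-form dual to X; in mechanics it is the
  momentum generating the flow of X.\<close>

definition momentum :: "'a::euclidean_space set \<Rightarrow> ('a \<Rightarrow> 'a) \<Rightarrow> 'a \<times> 'a \<Rightarrow> real"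
  where "momentum M X = (\<lambda>(x, w). if (x, w) \<in> unit_bundle M then X x \<bullet> w else 0)"

lemma mdiff_momentum:
  assumes X: "X \<in> vector_fields M" and xw: "(x, w) \<in> unit_bundle M"
    and g: "\<And>v. v \<in> tangent_space M x \<Longrightarrow> g \<bullet> v = mdiff M X x v \<bullet> w"
    and ab: "(a, b) \<in> tangent_space (tangent_bundle M) (x, w)"
  shows "mdiff (unit_bundle M) (momentum M X) (x, w) (a, b) = X x \<bullet> b + g \<bullet> a"
proof -
  have x: "x \<in> M"
    using xw by (auto simp: unit_bundle_def tangent_bundle_def)
  obtain U F where U: "open U" "x \<in> U" "smooth_on F U" "\<And>x. x \<in> M \<inter> U \<Longrightarrow> F x = X x"
    using smooth_fun_local_extension[OF vector_fieldsD(1)[OF X] x] by metis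
  have mdF: "mdiff (unit_bundle M) (momentum M X) (x, w) (a, b) =
      (\<lambda>z. F x \<bullet> snd z + dderiv F x (fst z) \<bullet> w) (a, b)"
  proof (rule mdiff_eqI[where U = "U \<times> UNIV"])
    show "(a, b) \<in> tangent_space (unit_bundle M) (x, w)"
      using ab tangent_space_unit_bundle[OF xw] by simp
    show "open (U \<times> (UNIV :: 'a set))" "(x, w) \<in> U \<times> UNIV"
      using U by (auto simp: open_Times)
    have "((\<lambda>z. F (fst z)) has_derivative (\<lambda>z. dderiv F x (fst z))) (at (x, w))"
      by (rule has_derivative_compose[OF bounded_linear_imp_has_derivative[OF bounded_linear_fst]])
        (use smooth_on_has_derivative[OF U(3,2)] in simp)
    then show "((\<lambda>z. F (fst z) \<bullet> snd z) has_derivative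
        (\<lambda>z. F x \<bullet> snd z + dderiv F x (fst z) \<bullet> w)) (at (x, w))"
      by (auto intro!: derivative_eq_intros)
    show "F (fst z) \<bullet> snd z = momentum M X z" if "z \<in> unit_bundle M \<inter> U \<times> UNIV" for z
      using that U(4)[of "fst z"]
      by (auto simp: momentum_def unit_bundle_def tangent_bundle_def)
  qed
  have a: "a \<in> tangent_space M x"
    using tangent_bundle_horizontal[OF ab] by simp
  have dF: "dderiv F x a \<bullet> w = g \<bullet> a"
    using mdiff_extension[OF U(1,3,4,2) a] g[OF a] by simp
  have Fx: "F x = X x"
    by (rule U(4)) (use U(2) x in simp)
  show ?thesis
    unfolding mdF by (simp add: dF Fx)
qed

text \<open>The differential of \<open>X(x) \<bullet> w\<close> is \<open>X \<bullet> dw + (DX)\<^sup>T w \<bullet> dx\<close>, so the bracket of two such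
  functions is \<open>w \<bullet> (DY X - DX Y)\<close>.\<close>

lemma poisson_momentum:
  assumes M: "submanifold M" and X: "X \<in> vector_fields M" and Y: "Y \<in> vector_fields M"
  shows "poisson M (momentum M X) (momentum M Y) = momentum M (lie_bracket M X Y)"
proof
  fix z
  show "poisson M (momentum M X) (momentum M Y) z = momentum M (lie_bracket M X Y) z"
  proof (cases "z \<in> unit_bundle M")
    case True
    obtain x w where z: "z = (x, w)" by (cases z)
    note xw = True[unfolded z]
    have x: "x \<in> M"
      using xw by (auto simp: unit_bundle_def tangent_bundle_def)
    have *: "\<exists>g. \<forall>v\<in>tangent_space M x. g \<bullet> v = mdiff M Z x v \<bullet> w"
      if Z: "Z \<in> vector_fields M" for Z
    proof -
      obtain g where "\<And>v. v \<in> tangent_space M x \<Longrightarrow> g \<bullet> v = mdiff M (\<lambda>q. Z q \<bullet> w) x v"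
        using gradient_exists[OF smooth_fun_inner[OF vector_fieldsD(1)[OF Z] smooth_fun_const] x] by metis
      moreover have "mdiff M (\<lambda>q. Z q \<bullet> w) x v = mdiff M Z x v \<bullet> w" if "v \<in> tangent_space M x" for v
        using mdiff_inner[OF vector_fieldsD(1)[OF Z] smooth_fun_const that] mdiff_const[OF that, of w] by simp
      ultimately show ?thesis by auto
    qed
    obtain A where A: "\<And>v. v \<in> tangent_space M x \<Longrightarrow> A \<bullet> v = mdiff M X x v \<bullet> w"
      using *[OF X] by blast
    obtain B where B: "\<And>v. v \<in> tangent_space M x \<Longrightarrow> B \<bullet> v = mdiff M Y x v \<bullet> w"
      using *[OF Y] by blast
    have "poisson M (momentum M X) (momentum M Y) (x, w) = B \<bullet> X x - A \<bullet> Y x"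
      by (rule poisson_eq[OF M xw vector_fieldsD(2)[OF X x] vector_fieldsD(2)[OF Y x]
          mdiff_momentum[OF X xw A] mdiff_momentum[OF Y xw B]])
    also have "\<dots> = lie_bracket M X Y x \<bullet> w"
      using A[OF vector_fieldsD(2)[OF Y x]] B[OF vector_fieldsD(2)[OF X x]]
      by (simp add: lie_bracket_eq[OF M X Y x] inner_diff_left)
    finally show ?thesis using xw by (simp add: z momentum_def)
  next
    case False
    then show ?thesis by (cases z) (simp add: poisson_outside momentum_def)
  qed
qed


section \<open>One-forms and vector fields\<close>

text \<open>The inverse of the duality \<open>sharp\<close>.\<close>

definition flat :: "'a::euclidean_space set \<Rightarrow> ('a \<Rightarrow> 'a) \<Rightarrow> 'a \<Rightarrow> 'a \<Rightarrow> real"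
  where "flat M X = (\<lambda>x w. if (x, w) \<in> tangent_bundle M then X x \<bullet> w else 0)"

lemma sharp_eqI:
  assumes "submanifold M" "v \<in> tangent_space M x" "\<And>w. w \<in> tangent_space M x \<Longrightarrow> \<eta> x w = v \<bullet> w"
  shows "sharp M \<eta> x = v"
proof -
  have x: "x \<in> M" using tangent_space_base[OF assms(2)] .
  have "(THE v. v \<in> tangent_space M x \<and> (\<forall>w\<in>tangent_space M x. \<eta> x w = v \<bullet> w)) = v"
  proof (rule the_equality)
    fix u assume u: "u \<in> tangent_space M x \<and> (\<forall>w\<in>tangent_space M x. \<eta> x w = u \<bullet> w)"
    then have "u - v \<in> tangent_space M x"
      using subspace_diff[OF subspace_tangent_space[OF assms(1) x]] assms(2) by blast
    then have "u \<bullet> (u - v) = v \<bullet> (u - v)" using u assms(3) by metis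
    then have "(u - v) \<bullet> (u - v) = 0" by (simp add: inner_diff_left)
    then show "u = v" by simp
  qed (use assms in auto)
  then show ?thesis using x by (simp add: sharp_def)
qed

lemma flat_one_forms:
  assumes "X \<in> vector_fields M"
  shows "flat M X \<in> one_forms M"
proof -
  have "\<exists>U b. open U \<and> p \<in> U \<and> smooth_on b U \<and>
      (\<forall>x\<in>M \<inter> U. \<forall>v\<in>tangent_space M x. flat M X x v = b x \<bullet> v)" if p: "p \<in> M" for p
  proof -
    obtain U F where "open U" "p \<in> U" "smooth_on F U" "\<And>x. x \<in> M \<inter> U \<Longrightarrow> F x = X x"
      using smooth_fun_local_extension[OF vector_fieldsD(1)[OF assms] p] by metis
    then show ?thesis
      by (intro exI[of _ U] exI[of _ F]) (auto simp: flat_def tangent_bundle_def)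
  qed
  then show ?thesis
    by (simp add: one_forms_def flat_def)
qed

lemma sharp_flat:
  assumes "submanifold M" "X \<in> vector_fields M"
  shows "sharp M (flat M X) = X"
proof
  fix x show "sharp M (flat M X) x = X x"
  proof (cases "x \<in> M")
    case True
    then show ?thesis
      using vector_fieldsD(2)[OF assms(2)]
      by (intro sharp_eqI[OF assms(1)]) (auto simp: flat_def tangent_bundle_def)
  next
    case False
    then show ?thesis using vector_fieldsD(3)[OF assms(2)] by (simp add: sharp_def)
  qed
qed

text \<open>The coefficient vector of a one-form becomes tangent by removing its component along
  the normal N, and this keeps it smooth.\<close>

lemma sharp_vector_field:
  assumes "smooth_hypersurface \<gamma>" "\<eta> \<in> one_forms \<gamma>"
  shows "sharp \<gamma> \<eta> \<in> vector_fields \<gamma>" and "flat \<gamma> (sharp \<gamma> \<eta>) = \<eta>"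
proof -
  note M = hypersurface_submanifold[OF assms(1)]
  have loc: "\<exists>U F. open U \<and> p \<in> U \<and> smooth_on F U \<and> (\<forall>x\<in>\<gamma> \<inter> U. F x = sharp \<gamma> \<eta> x \<and>
      sharp \<gamma> \<eta> x \<in> tangent_space \<gamma> x \<and> (\<forall>w\<in>tangent_space \<gamma> x. \<eta> x w = sharp \<gamma> \<eta> x \<bullet> w))"
    if p: "p \<in> \<gamma>" for p
  proof -
    obtain U r N where U: "p \<in> U" "smooth_retraction \<gamma> U r" "smooth_on N U"
      "\<And>x. x \<in> U \<Longrightarrow> N x \<noteq> 0" "\<And>x. x \<in> \<gamma> \<inter> U \<Longrightarrow> tangent_space \<gamma> x = {v. N x \<bullet> v = 0}"
      by (rule hypersurface_local_structure[OF assms(1) p]) (rule that)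
    obtain V b where V: "open V" "p \<in> V" "smooth_on b V"
      "\<And>x v. x \<in> \<gamma> \<inter> V \<Longrightarrow> v \<in> tangent_space \<gamma> x \<Longrightarrow> \<eta> x v = b x \<bullet> v"
      using assms(2) p unfolding one_forms_def by blast
    let ?W = "U \<inter> V"
    define F where "F x = b x - ((N x \<bullet> b x) * inverse (N x \<bullet> N x)) *\<^sub>R N x" for x
    have W: "open ?W" using smooth_retractionD(1)[OF U(2)] V(1) by auto
    have sm: "smooth_on N ?W" "smooth_on b ?W"
      using smooth_on_subset[OF U(3)] smooth_on_subset[OF V(3)] by auto
    have "smooth_on F ?W"
      unfolding F_def
      by (intro smooth_on_diff smooth_on_scaleR smooth_on_bilinear[OF bounded_bilinear_mult]
          smooth_on_inverse smooth_on_inner sm W) (use U(4) in auto)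
    moreover have "sharp \<gamma> \<eta> x = F x \<and> F x \<in> tangent_space \<gamma> x \<and>
        (\<forall>w\<in>tangent_space \<gamma> x. \<eta> x w = F x \<bullet> w)" if x: "x \<in> \<gamma> \<inter> ?W" for x
    proof -
      have T: "tangent_space \<gamma> x = {v. N x \<bullet> v = 0}" and N: "N x \<noteq> 0"
        using U(4,5) x by auto
      have F: "F x \<in> tangent_space \<gamma> x"
        using N by (simp add: T F_def inner_diff_right)
      have \<eta>: "\<eta> x w = F x \<bullet> w" if w: "w \<in> tangent_space \<gamma> x" for w
        using V(4)[OF _ w] x w by (simp add: T F_def inner_diff_left)
      have "sharp \<gamma> \<eta> x = F x"
        by (rule sharp_eqI[OF M F]) (rule \<eta>)
      with F \<eta> show ?thesis by simp
    qed
    ultimately show ?thesis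
      using W U(1) V(2) by (intro exI[of _ ?W] exI[of _ F]) auto
  qed
  have T: "sharp \<gamma> \<eta> x \<in> tangent_space \<gamma> x" "\<And>w. w \<in> tangent_space \<gamma> x \<Longrightarrow> \<eta> x w = sharp \<gamma> \<eta> x \<bullet> w"
    if "x \<in> \<gamma>" for x
    using loc[OF that] that by blast+
  have "smooth_fun \<gamma> (sharp \<gamma> \<eta>)"
    unfolding smooth_fun_def using loc by metis
  moreover have "sharp \<gamma> \<eta> x = 0" if "x \<notin> \<gamma>" for x
    using that by (simp add: sharp_def)
  ultimately show "sharp \<gamma> \<eta> \<in> vector_fields \<gamma>"
    using T(1) by (simp add: vector_fields_def)
  show "flat \<gamma> (sharp \<gamma> \<eta>) = \<eta>"
    using T assms(2) by (auto simp: fun_eq_iff flat_def tangent_bundle_def one_forms_def)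
qed

lemma one_forms_eq_flat:
  assumes "smooth_hypersurface \<gamma>"
  shows "one_forms \<gamma> = flat \<gamma> ` vector_fields \<gamma>"
  using sharp_vector_field[OF assms] flat_one_forms by (metis (no_types) image_eqI image_subsetI subsetI subset_antisym)

lemma form_fun_flat: "form_fun M (flat M X) = momentum M X"
  by (auto simp: fun_eq_iff form_fun_def flat_def momentum_def unit_bundle_def)

text \<open>A vector is determined by its inner products with short vectors.\<close>

lemma inj_on_momentum:
  assumes M: "submanifold M"
  shows "inj_on (momentum M) (vector_fields M)"
proof (rule inj_onI, rule ext)
  fix X Y x assume X: "X \<in> vector_fields M" and Y: "Y \<in> vector_fields M"
    and eq: "momentum M X = momentum M Y"
  show "X x = Y x"
  proof (cases "x \<in> M")
    case True
    define d where "d = X x - Y x"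
    have d: "d \<in> tangent_space M x"
      unfolding d_def using True vector_fieldsD(2) X Y
      by (intro subspace_diff[OF subspace_tangent_space[OF M True]]) auto
    \<comment> \<open>The difference, rescaled into the unit ball.\<close>
    define w where "w = (1 / (1 + norm d)) *\<^sub>R d"
    have "w \<in> tangent_space M x"
      unfolding w_def by (rule subspace_scale[OF subspace_tangent_space[OF M True] d])
    moreover have "norm w < 1"
      by (simp add: w_def divide_simps) (smt (verit) norm_ge_zero)
    ultimately have "(x, w) \<in> unit_bundle M"
      using True by (simp add: unit_bundle_def tangent_bundle_def)
    then have "X x \<bullet> w = Y x \<bullet> w"
      using fun_cong[OF eq, of "(x, w)"] by (simp add: momentum_def)
    then have "d \<bullet> w = 0" by (simp add: d_def inner_diff_left)
    then have "d = 0"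
      by (simp add: w_def) (smt (verit) norm_ge_zero)
    then show ?thesis by (simp add: d_def)
  qed (use vector_fieldsD(3)[OF X] vector_fieldsD(3)[OF Y] in simp)
qed


section \<open>Transport of Lie algebra structures\<close>

lemma lie_algebra_transport:
  assumes L: "lie_algebra L brL" and h: "lie_isomorphism h L brL M brM"
  shows "lie_algebra M brM"
proof -
  have sub: "subspace L" and cl: "\<And>x y. x \<in> L \<Longrightarrow> y \<in> L \<Longrightarrow> brL x y \<in> L"
    using L by (auto simp: lie_algebra_def)
  have M: "M = h ` L" and add: "\<And>x y. x \<in> L \<Longrightarrow> y \<in> L \<Longrightarrow> h x + h y = h (x + y)"
    and scale: "\<And>c x. x \<in> L \<Longrightarrow> c *\<^sub>R h x = h (c *\<^sub>R x)"
    and br: "\<And>x y. x \<in> L \<Longrightarrow> y \<in> L \<Longrightarrow> brM (h x) (h y) = h (brL x y)"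
    using h by (auto simp: lie_isomorphism_def bij_betw_def)
  note L_cl = subspace_add[OF sub] subspace_scale[OF sub] subspace_0[OF sub] cl
  have h0: "0 = h 0"
    using scale[OF subspace_0[OF sub], of 0] by simp
  have "subspace (h ` L)"
    unfolding subspace_def by (auto simp: add scale h0 L_cl intro!: imageI)
  moreover have "brL (x + y) z = brL x z + brL y z" "brL x (y + z) = brL x y + brL x z"
    "brL (c *\<^sub>R x) y = c *\<^sub>R brL x y" "brL x (c *\<^sub>R y) = c *\<^sub>R brL x y" "brL x x = 0"
    "brL x (brL y z) + brL y (brL z x) + brL z (brL x y) = 0"
    if "x \<in> L" "y \<in> L" "z \<in> L" for x y z c
    using L that unfolding lie_algebra_def by blast+
  ultimately show ?thesis
    unfolding lie_algebra_def M by (simp add: add scale br L_cl) (simp add: h0)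
qed

lemma lie_isomorphism_inverse:
  assumes L: "lie_algebra L brL" and h: "lie_isomorphism h L brL M brM"
    and g: "\<And>x. x \<in> L \<Longrightarrow> g (h x) = x"
  shows "lie_isomorphism g M brM L brL"
proof -
  have cl: "\<And>x y. x \<in> L \<Longrightarrow> y \<in> L \<Longrightarrow> brL x y \<in> L" "\<And>x y. x \<in> L \<Longrightarrow> y \<in> L \<Longrightarrow> x + y \<in> L"
    "\<And>c x. x \<in> L \<Longrightarrow> c *\<^sub>R x \<in> L"
    using L by (auto simp: lie_algebra_def subspace_add subspace_scale)
  have M: "M = h ` L" and add: "\<And>x y. x \<in> L \<Longrightarrow> y \<in> L \<Longrightarrow> h x + h y = h (x + y)"
    and scale: "\<And>c x. x \<in> L \<Longrightarrow> c *\<^sub>R h x = h (c *\<^sub>R x)"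
    and br: "\<And>x y. x \<in> L \<Longrightarrow> y \<in> L \<Longrightarrow> brM (h x) (h y) = h (brL x y)"
    using h by (auto simp: lie_isomorphism_def bij_betw_def)
  have "bij_betw g (h ` L) L"
    by (rule bij_betw_byWitness[where f' = h]) (use g in auto)
  then show ?thesis
    unfolding lie_isomorphism_def M by (simp add: add scale br g cl)
qed


section \<open>The Lie algebra generated by the brackets\<close>

lemma sum_fun_apply: "(\<Sum>i\<in>A. F i) z = (\<Sum>i\<in>A. F i z)"
  by (induction A rule: infinite_finite_induct) auto

text \<open>Near each point, \<open>4 (g df - f dg)\<close> has the smooth coefficient vector
  \<open>4 (G grad F - F grad G)\<close>, with local extensions F and G.\<close>

lemma poisson_H_form_fun:
  fixes M :: "'a::euclidean_space set"
  assumes M: "submanifold M" and f: "smooth_fun M f" and g: "smooth_fun M g"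
  shows "poisson M (H M f) (H M g) \<in> form_fun M ` one_forms M"
proof
  define \<eta> where "\<eta> x w = (if (x, w) \<in> tangent_bundle M
    then 4 * (g x * mdiff M f x w - f x * mdiff M g x w) else 0)" for x w
  show "poisson M (H M f) (H M g) = form_fun M \<eta>"
  proof
    fix z :: "'a \<times> 'a"
    obtain x w where z: "z = (x, w)" by (cases z)
    have "(x, w) \<in> unit_bundle M \<Longrightarrow> (x, w) \<in> tangent_bundle M"
      by (simp add: unit_bundle_def)
    then show "poisson M (H M f) (H M g) z = form_fun M \<eta> z"
      using poisson_H[OF M f g, of x w]
      by (cases "z \<in> unit_bundle M") (simp_all add: z poisson_outside form_fun_def \<eta>_def)
  qed
  have "\<exists>U b. open U \<and> p \<in> U \<and> smooth_on b U \<and>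
      (\<forall>x\<in>M \<inter> U. \<forall>v\<in>tangent_space M x. \<eta> x v = b x \<bullet> v)" if p: "p \<in> M" for p
  proof -
    obtain U F G where U: "open U" "p \<in> U" "smooth_on F U" "smooth_on G U"
      "\<And>x. x \<in> M \<inter> U \<Longrightarrow> F x = f x" "\<And>x. x \<in> M \<inter> U \<Longrightarrow> G x = g x"
      using smooth_fun_local_extensions[OF f g p] by metis
    define b where "b x = 4 *\<^sub>R (G x *\<^sub>R grad F x - F x *\<^sub>R grad G x)" for x
    have "smooth_on b U"
      unfolding b_def
      by (intro smooth_on_diff smooth_on_scaleR smooth_on_const smooth_on_grad U)
    moreover have "\<eta> x v = b x \<bullet> v" if "x \<in> M \<inter> U" "v \<in> tangent_space M x" for x v
    proof -
      have x: "x \<in> M" "x \<in> U" using that by auto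
      show ?thesis
        using x that(2) U(5)[OF that(1)] U(6)[OF that(1)] 
          grad_inner[OF smooth_on_differentiable[OF U(3) x(2)]]
          grad_inner[OF smooth_on_differentiable[OF U(4) x(2)]]
          mdiff_extension[OF U(1,3,5) x(2) that(2)] mdiff_extension[OF U(1,4,6) x(2) that(2)]
        by (simp add: \<eta>_def b_def tangent_bundle_def inner_diff_left)
    qed
    ultimately show ?thesis
      using U(1,2) by (intro exI[of _ U] exI[of _ b]) simp
  qed
  then show "\<eta> \<in> one_forms M"
    by (simp add: one_forms_def \<eta>_def)
qed

text \<open>By \<open>{H\<^sub>f, H\<^sub>g} = 4 (g df - f dg)\<close> and
  \<open>X\<^sub>i dx\<^sub>i = (X\<^sub>i dx\<^sub>i - x\<^sub>i dX\<^sub>i) / 2 + d(x\<^sub>i X\<^sub>i) / 2\<close>, one bracket for each ambient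
  coordinate and a last one for the exact form \<open>d(x \<bullet> X) / 2\<close> suffice.\<close>

lemma momentum_as_sum_of_brackets:
  fixes X :: "'a::euclidean_space \<Rightarrow> 'a"
  assumes M: "submanifold M" and X: "X \<in> vector_fields M"
  obtains f g where "\<And>i. smooth_fun M (f i)" "\<And>i. smooth_fun M (g i)"
    "momentum M X = (\<Sum>i<DIM('a) + 1. poisson M (H M (f i)) (H M (g i)))"
proof -
  obtain e :: "nat \<Rightarrow> 'a" where "bij_betw e {0..<DIM('a)} Basis"
    using ex_bij_betw_nat_finite[OF finite_Basis] by blast
  then have e: "bij_betw e {..<DIM('a)} Basis"
    by (simp only: atLeast0LessThan)
  have reindex: "(\<Sum>i<DIM('a). (u \<bullet> e i) * (v \<bullet> e i)) = u \<bullet> v" for u v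
    using sum.reindex_bij_betw[OF e, of "\<lambda>b. (u \<bullet> b) * (v \<bullet> b)"] euclidean_inner[of u v] by simp
  note Xs = vector_fieldsD(1)[OF X]
  define f where "f i = (if i < DIM('a) then (\<lambda>x. (1/8) *\<^sub>R (x \<bullet> e i)) else (\<lambda>x. (1/8) *\<^sub>R (x \<bullet> X x)))" for i
  define g where "g i = (if i < DIM('a) then (\<lambda>x. X x \<bullet> e i) else (\<lambda>x. 1))" for i
  have coord: "smooth_fun M (\<lambda>x. x \<bullet> e i)" "smooth_fun M (\<lambda>x. x \<bullet> X x)" "smooth_fun M (\<lambda>x. X x \<bullet> e i)" for i
    by (intro smooth_fun_inner smooth_fun_ident smooth_fun_const Xs)+
  have f: "smooth_fun M (f i)" and g: "smooth_fun M (g i)" for i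
    using coord by (auto simp: f_def g_def intro: smooth_fun_scaleR[OF smooth_fun_const] smooth_fun_const
        simp del: real_scaleR_def)
  have "momentum M X z = (\<Sum>i<DIM('a) + 1. poisson M (H M (f i)) (H M (g i))) z" for z
  proof (cases "z \<in> unit_bundle M")
    case True
    obtain x w where z: "z = (x, w)" by (cases z)
    note xw = True[unfolded z]
    have w: "w \<in> tangent_space M x"
      using xw by (auto simp: unit_bundle_def tangent_bundle_def)
    have 1: "mdiff M (\<lambda>x. (1/8) *\<^sub>R (x \<bullet> e i)) x w = (w \<bullet> e i) / 8" for i
      using mdiff_scaleR_const[OF coord(1) w, of "1/8"] mdiff_inner[OF smooth_fun_ident smooth_fun_const w]
        mdiff_id[OF w] mdiff_const[OF w, of "e i"] by simp
    have 2: "mdiff M (\<lambda>x. X x \<bullet> e i) x w = mdiff M X x w \<bullet> e i" for i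
      using mdiff_inner[OF Xs smooth_fun_const w] mdiff_const[OF w, of "e i"] by simp
    have 3: "mdiff M (\<lambda>x. (1/8) *\<^sub>R (x \<bullet> X x)) x w = (x \<bullet> mdiff M X x w + w \<bullet> X x) / 8"
      using mdiff_scaleR_const[OF coord(2) w, of "1/8"] mdiff_inner[OF smooth_fun_ident Xs w]
        mdiff_id[OF w] by simp
    have coordinate: "f i x = (x \<bullet> e i) / 8" "mdiff M (f i) x w = (w \<bullet> e i) / 8"
      "g i x = X x \<bullet> e i" "mdiff M (g i) x w = mdiff M X x w \<bullet> e i" if "i < DIM('a)" for i
      using that 1 2 by (simp_all add: f_def g_def del: real_scaleR_def) simp
    have exact: "f DIM('a) x = (x \<bullet> X x) / 8" "g DIM('a) x = 1" "mdiff M (g DIM('a)) x w = 0"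
      "mdiff M (f DIM('a)) x w = (x \<bullet> mdiff M X x w + w \<bullet> X x) / 8"
      using 3 mdiff_const[OF w, of "1::real"] by (simp_all add: f_def g_def del: real_scaleR_def) simp
    have "(\<Sum>i<DIM('a) + 1. poisson M (H M (f i)) (H M (g i))) z =
        (\<Sum>i<DIM('a) + 1. 4 * (g i x * mdiff M (f i) x w - f i x * mdiff M (g i) x w))"
      using poisson_H[OF M f g xw] by (simp only: sum_fun_apply z)
    also have "\<dots> = (\<Sum>i<DIM('a). (X x \<bullet> e i) * (w \<bullet> e i) / 2 - (x \<bullet> e i) * (mdiff M X x w \<bullet> e i) / 2)
        + (x \<bullet> mdiff M X x w + w \<bullet> X x) / 2"
      by (simp add: coordinate exact field_simps)
    also have "\<dots> = (X x \<bullet> w) / 2 - (x \<bullet> mdiff M X x w) / 2 + (x \<bullet> mdiff M X x w + w \<bullet> X x) / 2"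
      by (simp only: sum_subtractf sum_divide_distrib[symmetric] reindex)
    finally show ?thesis
      using xw by (simp add: z momentum_def inner_commute add_divide_distrib)
  next
    case False
    then show ?thesis
      by (cases z) (simp add: sum_fun_apply poisson_outside momentum_def)
  qed
  then show thesis using that f g by blast
qed

text \<open>The vector fields are the model: \<open>flat\<close> carries their Lie algebra to the 1-forms and
  \<open>momentum\<close> carries it to the functions. The number of brackets is \<open>n + 2\<close>, which is at most
  \<open>2 n + 1\<close> because \<open>n \<ge> 1\<close>.\<close>

theorem proposition1p15:
  fixes \<gamma> :: "'a::euclidean_space set" and n :: nat
  assumes "n \<ge> 1" and "DIM('a) = n + 1"
    and "smooth_hypersurface \<gamma>"
    and "closed_strictly_convex \<gamma> \<or> local_hypersurface \<gamma>"
  shows "lie_algebra (span (H_brackets \<gamma>)) (poisson \<gamma>)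
    \<and> (\<forall>h \<in> span (H_brackets \<gamma>). \<exists>m f g. m \<le> 2 * n + 1 \<and>
          (\<forall>i<m. smooth_fun \<gamma> (f i) \<and> smooth_fun \<gamma> (g i)) \<and>
          h = (\<Sum>i<m. poisson \<gamma> (H \<gamma> (f i)) (H \<gamma> (g i))))
    \<and> span (H_brackets \<gamma>) = form_fun \<gamma> ` one_forms \<gamma>
    \<and> lie_algebra (one_forms \<gamma>) (form_bracket \<gamma>)
    \<and> lie_isomorphism (form_fun \<gamma>)
          (one_forms \<gamma>) (form_bracket \<gamma>) (span (H_brackets \<gamma>)) (poisson \<gamma>)
    \<and> lie_algebra (vector_fields \<gamma>) (lie_bracket \<gamma>)
    \<and> lie_isomorphism (sharp \<gamma>)
          (one_forms \<gamma>) (form_bracket \<gamma>) (vector_fields \<gamma>) (lie_bracket \<gamma>)"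
proof -
  let ?V = "vector_fields \<gamma>" and ?O = "one_forms \<gamma>" and ?F = "form_fun \<gamma> ` one_forms \<gamma>"
  note M = hypersurface_submanifold[OF assms(3)]
  note V = lie_algebra_vector_fields[OF M]
  note O = one_forms_eq_flat[OF assms(3)]
  have F: "?F = momentum \<gamma> ` ?V"
    by (simp add: O image_image form_fun_flat)
  have inj: "inj_on (form_fun \<gamma>) ?O"
    using inj_on_momentum[OF M] by (auto simp: O inj_on_def form_fun_flat)
  have bracket: "form_bracket \<gamma> (flat \<gamma> X) (flat \<gamma> Y) = flat \<gamma> (lie_bracket \<gamma> X Y)"
    if "X \<in> ?V" "Y \<in> ?V" for X Y
    using inv_into_f_f[OF inj flat_one_forms[OF lie_bracket_vector_fields[OF M that]]]
    by (simp add: form_bracket_def form_fun_flat poisson_momentum[OF M that])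
  have flat: "lie_isomorphism (flat \<gamma>) ?V (lie_bracket \<gamma>) ?O (form_bracket \<gamma>)"
  proof -
    have "inj_on (flat \<gamma>) ?V"
      using sharp_flat[OF M] by (metis inj_on_def)
    then show ?thesis
      unfolding lie_isomorphism_def O bij_betw_def
      by (auto simp: bracket) (auto simp: flat_def fun_eq_iff scaleR_fun_def inner_add_left)
  qed
  have momentum: "lie_isomorphism (momentum \<gamma>) ?V (lie_bracket \<gamma>) ?F (poisson \<gamma>)"
    unfolding lie_isomorphism_def F bij_betw_def
    using inj_on_momentum[OF M]
    by (auto simp: poisson_momentum[OF M]) (auto simp: momentum_def fun_eq_iff scaleR_fun_def inner_add_left)
  note LO = lie_algebra_transport[OF V flat] and LF = lie_algebra_transport[OF V momentum]
  have form_fun: "lie_isomorphism (form_fun \<gamma>) ?O (form_bracket \<gamma>) ?F (poisson \<gamma>)"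
  proof -
    have "form_fun \<gamma> (form_bracket \<gamma> \<eta> \<theta>) = poisson \<gamma> (form_fun \<gamma> \<eta>) (form_fun \<gamma> \<theta>)"
      if "\<eta> \<in> ?O" "\<theta> \<in> ?O" for \<eta> \<theta>
      using that by (auto simp: O bracket form_fun_flat poisson_momentum[OF M])
    then show ?thesis
      using inj by (auto simp: lie_isomorphism_def bij_betw_def form_fun_def fun_eq_iff scaleR_fun_def)
  qed
  have sharp: "lie_isomorphism (sharp \<gamma>) ?O (form_bracket \<gamma>) ?V (lie_bracket \<gamma>)"
    by (rule lie_isomorphism_inverse[OF V flat]) (rule sharp_flat[OF M])
  have sum: "\<exists>f g. (\<forall>i. smooth_fun \<gamma> (f i) \<and> smooth_fun \<gamma> (g i)) \<and>
      h = (\<Sum>i<n + 2. poisson \<gamma> (H \<gamma> (f i)) (H \<gamma> (g i)))" if "h \<in> ?F" for h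
  proof -
    obtain X where X: "X \<in> ?V" "h = momentum \<gamma> X"
      using \<open>h \<in> ?F\<close> F by blast
    obtain f g where "\<And>i. smooth_fun \<gamma> (f i)" "\<And>i. smooth_fun \<gamma> (g i)"
      "momentum \<gamma> X = (\<Sum>i<DIM('a) + 1. poisson \<gamma> (H \<gamma> (f i)) (H \<gamma> (g i)))"
      by (rule momentum_as_sum_of_brackets[OF M X(1)]) (rule that)
    moreover have "DIM('a) + 1 = n + 2" using assms(2) by simp
    ultimately show ?thesis
      using X(2) by (intro exI[of _ f] exI[of _ g]) (simp only: simp_thms)
  qed
  have span: "span (H_brackets \<gamma>) = ?F"
  proof
    have "H_brackets \<gamma> \<subseteq> ?F"
      using poisson_H_form_fun[OF M] by (auto simp: H_brackets_def)
    moreover have "subspace ?F"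
      using LF by (simp add: lie_algebra_def)
    ultimately show "span (H_brackets \<gamma>) \<subseteq> ?F"
      by (rule span_minimal)
    show "?F \<subseteq> span (H_brackets \<gamma>)"
    proof
      fix h assume "h \<in> ?F"
      from sum[OF this] obtain f g where fg: "(\<forall>i. smooth_fun \<gamma> (f i) \<and> smooth_fun \<gamma> (g i)) \<and>
        h = (\<Sum>i<n + 2. poisson \<gamma> (H \<gamma> (f i)) (H \<gamma> (g i)))"
        by (elim exE) (rule that)
      then have "poisson \<gamma> (H \<gamma> (f i)) (H \<gamma> (g i)) \<in> H_brackets \<gamma>" for i
        unfolding H_brackets_def by blast
      then show "h \<in> span (H_brackets \<gamma>)"
        unfolding conjunct2[OF fg] by (intro span_sum span_base)
    qed
  qed
  have "\<exists>m f g. m \<le> 2 * n + 1 \<and> (\<forall>i<m. smooth_fun \<gamma> (f i) \<and> smooth_fun \<gamma> (g i)) \<and>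
      h = (\<Sum>i<m. poisson \<gamma> (H \<gamma> (f i)) (H \<gamma> (g i)))" if h: "h \<in> ?F" for h
  proof -
    from sum[OF h] obtain f g where "(\<forall>i. smooth_fun \<gamma> (f i) \<and> smooth_fun \<gamma> (g i)) \<and>
      h = (\<Sum>i<n + 2. poisson \<gamma> (H \<gamma> (f i)) (H \<gamma> (g i)))"
      by (elim exE) (rule that)
    then show ?thesis
      using assms(1) by (intro exI[of _ "n + 2"] exI[of _ f] exI[of _ g]) simp
  qed
  then show ?thesis
    using LF LO V form_fun sharp unfolding span by blast
qed

end
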